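(* Let $(X,\mathsf d)$ be a complete separable metric space and $\mu$ a Borel probability measure on $X$ with $\int_X \mathsf d^4(x_0,y)\,d\mu(y)<\infty$ for some $x_0\in X$. Let $T$ be the associated centered operator on $L^2(X,\mu)$ (see context), $\{u_i\}_{i\ge1}$ an orthonormal basis of $L^2(X,\mu)$ consisting of eigenfunctions of $T$, and $\lambda_i$ the eigenvalue corresponding to $u_i$. Assume that $T$ is trace-class, i.e. $\sum_i|\lambda_i|<+\infty$, and that $\mu$-a.e. point $x\in X$ is a Lebesgue point of the function $f:=\sum_{i=1}^\infty|\lambda_i|u_i^2\in L^1(X,\mu)$. Let $M$ and $M^-$ be the maps built from the positive, respectively negative, eigenvalues of $T$ as in the context. Then \[ \|M(x)-M(y)\|_2^2\ \ge\ \mathsf d^2(x,y)\qquad\text{for }\mu\otimes\mu\text{-a.e. }(x,y)\in X\times X. \] Moreover, the map $x\mapsto N(x):=(M(x),M^-(x))$ from $X$ to the Krein space $\mathcal K:=\ell^2\times\ell^2$, with indefinite inner product $((f_1,g_1),(f_2,g_2))_{\mathcal K}:=(f_1,f_2)-(g_1,g_2)$ and pseudo-norm $\|(f,g)\|_{\mathcal K}^2:=\|f\|_2^2-\|g\|_2^2$, is an a.e. isometry in the sense that \[ \|N(x)-N(y)\|_{\mathcal K}^2=\mathsf d^2(x,y)\qquad\text{for }\mu\otimes\mu\text{-a.e. }(x,y)\in X\times X. \]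
   Context: Set $\mathsf k(x,y):=-\tfrac12\mathsf d^2(x,y)$ and $(Kg)(x):=\int_X\mathsf k(x,y)g(y)\,d\mu(y)$ on $L^2(X,\mu)$. Let $Pg:=g-\int_X g\,d\mu$ and $T:=PKP$. Under the fourth moment condition $T$ is a self-adjoint Hilbert--Schmidt operator, namely the integral operator with kernel \[ \mathsf k_T(x,y)=\mathsf k(x,y)-\int_X\mathsf k(x,y')\,d\mu(y')-\int_X\mathsf k(x',y)\,d\mu(x')+\int_X\int_X\mathsf k(x',y')\,d\mu(x')\,d\mu(y'). \] An eigenfunction $u$ with eigenvalue $\lambda\ne0$ is identified with its continuous representative $u(x)=\lambda^{-1}\int_X\mathsf k_T(x,y)u(y)\,d\mu(y)$; terms with $\lambda_i=0$ are zero in the sums, so $f$ is defined pointwise with values in $[0,+\infty]$. A point $x$ is a Lebesgue point of $f$ if $f(x)<\infty$, $\mu(B_r(x))>0$ for all $r>0$, and $\lim_{r\to0}\frac1{\mu(B_r(x))}\int_{B_r(x)}|f-f(x)|\,d\mu=0$. Let $\lambda_1^+(T)\ge\lambda_2^+(T)\ge\dots>0$ be the positive eigenvalues of $T$ counted with multiplicity and $u_j^+(T)$ corresponding orthonormal eigenfunctions; let $\lambda_j^-(T)>0$ be the absolute values of the negative eigenvalues of $T$ counted with multiplicity and $u_j^-(T)$ corresponding orthonormal eigenfunctions. The infinite MDS map is $M(x):=(\sqrt{\lambda_j^+(T)}\,u_j^+(T)(x))_{j\ge1}$, and $M^-(x):=(\sqrt{\lambda_j^-(T)}\,u_j^-(T)(x))_{j\ge1}$,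 the sequences being extended by zeros if there are only finitely many eigenvalues of the given sign. When $T$ is trace-class, $M,M^-\in L^2(X,\mu;\ell^2)$; in particular $M(x),M^-(x)\in\ell^2$ for $\mu$-a.e. $x$. $\|\cdot\|_2$ is the norm of $\ell^2$. *)

theory Defs
  imports "HOL-Probability.Probability"
begin

text \<open>
  Elements of the real space L2(\<mu>) are represented by square-integrable functions; equality in L2
  is equality \<mu>-almost everywhere.
\<close>

definition L2 :: "'a measure \<Rightarrow> ('a \<Rightarrow> real) set" where
  "L2 \<mu> = {g. g \<in> borel_measurable \<mu> \<and> integrable \<mu> (\<lambda>x. (g x)\<^sup>2)}"

definition L2_orthonormal :: "'a measure \<Rightarrow> 'i set \<Rightarrow> ('i \<Rightarrow> 'a \<Rightarrow> real) \<Rightarrow> bool" where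
  "L2_orthonormal \<mu> I u \<longleftrightarrow>
     (\<forall>i\<in>I. u i \<in> L2 \<mu>) \<and>
     (\<forall>i\<in>I. \<forall>j\<in>I. (\<integral>x. u i x * u j x \<partial>\<mu>) = (if i = j then 1 else 0))"

definition L2_orthonormal_basis :: "'a measure \<Rightarrow> 'i set \<Rightarrow> ('i \<Rightarrow> 'a \<Rightarrow> real) \<Rightarrow> bool" where
  "L2_orthonormal_basis \<mu> I u \<longleftrightarrow>
     L2_orthonormal \<mu> I u \<and>
     (\<forall>g\<in>L2 \<mu>. \<forall>\<epsilon>>0. \<exists>F c. finite F \<and> F \<subseteq> I \<and>
        (\<integral>x. (g x - (\<Sum>i\<in>F. c i * u i x))\<^sup>2 \<partial>\<mu>) < \<epsilon>)"

definition eigenspace ::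
  "'a measure \<Rightarrow> (('a \<Rightarrow> real) \<Rightarrow> 'a \<Rightarrow> real) \<Rightarrow> real \<Rightarrow> ('a \<Rightarrow> real) set" where
  "eigenspace \<mu> A l = {g \<in> L2 \<mu>. AE x in \<mu>. A g x = l * g x}"

definition L2_independent :: "'a measure \<Rightarrow> ('a \<Rightarrow> real) set \<Rightarrow> bool" where
  "L2_independent \<mu> F \<longleftrightarrow>
     (\<forall>c. (AE x in \<mu>. (\<Sum>g\<in>F. c g * g x) = 0) \<longrightarrow> (\<forall>g\<in>F. c g = 0))"

text \<open>The multiplicity is the dimension in L2 of the eigenspace; it is 0 if \<open>l\<close> is not an eigenvalue.\<close>

definition multiplicity_of_eigenvalue ::
  "'a measure \<Rightarrow> (('a \<Rightarrow> real) \<Rightarrow> 'a \<Rightarrow> real) \<Rightarrow> real \<Rightarrow> enat" where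
  "multiplicity_of_eigenvalue \<mu> A l =
     Sup {enat (card F) |F. finite F \<and> F \<subseteq> eigenspace \<mu> A l \<and> L2_independent \<mu> F}"

definition mds_kernel :: "'a::metric_space \<Rightarrow> 'a \<Rightarrow> real" where
  "mds_kernel x y = - (1/2) * (dist x y)\<^sup>2"

definition mds_K :: "'a::metric_space measure \<Rightarrow> ('a \<Rightarrow> real) \<Rightarrow> 'a \<Rightarrow> real" where
  "mds_K \<mu> g x = (\<integral>y. mds_kernel x y * g y \<partial>\<mu>)"

definition mds_P :: "'a measure \<Rightarrow> ('a \<Rightarrow> real) \<Rightarrow> 'a \<Rightarrow> real" where
  "mds_P \<mu> g x = g x - (\<integral>y. g y \<partial>\<mu>)"

definition mds_T :: "'a::metric_space measure \<Rightarrow> ('a \<Rightarrow> real) \<Rightarrow> 'a \<Rightarrow> real" where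
  "mds_T \<mu> g = mds_P \<mu> (mds_K \<mu> (mds_P \<mu> g))"

definition mds_kernel_T :: "'a::metric_space measure \<Rightarrow> 'a \<Rightarrow> 'a \<Rightarrow> real" where
  "mds_kernel_T \<mu> x y =
     mds_kernel x y - (\<integral>y'. mds_kernel x y' \<partial>\<mu>) - (\<integral>x'. mds_kernel x' y \<partial>\<mu>)
     + (\<integral>y'. (\<integral>x'. mds_kernel x' y' \<partial>\<mu>) \<partial>\<mu>)"

text \<open>
  The continuous representative of an eigenfunction \<open>u\<close> with eigenvalue \<open>l \<noteq> 0\<close>. For \<open>l = 0\<close> the
  value is the junk value 0; below it only occurs multiplied by 0.
\<close>

definition continuous_rep ::
  "'a::metric_space measure \<Rightarrow> real \<Rightarrow> ('a \<Rightarrow> real) \<Rightarrow> 'a \<Rightarrow> real" where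
  "continuous_rep \<mu> l u x = (1 / l) * (\<integral>y. mds_kernel_T \<mu> x y * u y \<partial>\<mu>)"

definition weighted_square_sum ::
  "'a::metric_space measure \<Rightarrow> nat set \<Rightarrow> (nat \<Rightarrow> real) \<Rightarrow> (nat \<Rightarrow> 'a \<Rightarrow> real) \<Rightarrow> 'a \<Rightarrow> ennreal" where
  "weighted_square_sum \<mu> I lam u x =
     (\<Sum>i. if i \<in> I then ennreal (\<bar>lam i\<bar> * (continuous_rep \<mu> (lam i) (u i) x)\<^sup>2) else 0)"

definition lebesgue_point :: "'a::metric_space measure \<Rightarrow> ('a \<Rightarrow> ennreal) \<Rightarrow> 'a \<Rightarrow> bool" where
  "lebesgue_point \<mu> f x \<longleftrightarrow>
     f x < \<infinity> \<and>
     (\<forall>r>0. emeasure \<mu> (ball x r) > 0) \<and>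
     ((\<lambda>r. (\<integral>\<^sup>+y\<in>ball x r. e2ennreal \<bar>enn2ereal (f y) - enn2ereal (f x)\<bar> \<partial>\<mu>)
            / emeasure \<mu> (ball x r)) \<longlongrightarrow> 0) (at_right 0)"

text \<open>
  For a sign \<open>s = 1\<close> or \<open>s = -1\<close>: the sequence \<open>l\<close> lists the absolute values of the eigenvalues of sign
  \<open>s\<close>, counted with multiplicity, and is extended by zeros if there are only finitely many of them;
  the functions \<open>u j\<close> with \<open>l j > 0\<close> are corresponding orthonormal eigenfunctions, and the other
  \<open>u j\<close> are irrelevant. Indices start at 0. No monotonicity is imposed here.
\<close>

definition signed_eigen_enumeration ::
  "'a measure \<Rightarrow> (('a \<Rightarrow> real) \<Rightarrow> 'a \<Rightarrow> real) \<Rightarrow> real \<Rightarrow> (nat \<Rightarrow> real) \<Rightarrow> (nat \<Rightarrow> 'a \<Rightarrow> real) \<Rightarrow> bool" where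
  "signed_eigen_enumeration \<mu> A s l u \<longleftrightarrow>
     (\<forall>j. l j \<ge> 0) \<and>
     (\<forall>i j. i \<le> j \<and> l j > 0 \<longrightarrow> l i > 0) \<and>
     (\<forall>t>0. finite {j. l j = t} \<and>
        enat (card {j. l j = t}) = multiplicity_of_eigenvalue \<mu> A (s * t)) \<and>
     (\<forall>j. l j > 0 \<longrightarrow> u j \<in> eigenspace \<mu> A (s * l j)) \<and>
     L2_orthonormal \<mu> {j. l j > 0} u"

definition positive_eigen_enumeration ::
  "'a measure \<Rightarrow> (('a \<Rightarrow> real) \<Rightarrow> 'a \<Rightarrow> real) \<Rightarrow> (nat \<Rightarrow> real) \<Rightarrow> (nat \<Rightarrow> 'a \<Rightarrow> real) \<Rightarrow> bool" where
  "positive_eigen_enumeration \<mu> A l u \<longleftrightarrow> decseq l \<and> signed_eigen_enumeration \<mu> A 1 l u"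

definition negative_eigen_enumeration ::
  "'a measure \<Rightarrow> (('a \<Rightarrow> real) \<Rightarrow> 'a \<Rightarrow> real) \<Rightarrow> (nat \<Rightarrow> real) \<Rightarrow> (nat \<Rightarrow> 'a \<Rightarrow> real) \<Rightarrow> bool" where
  "negative_eigen_enumeration \<mu> A l u \<longleftrightarrow> signed_eigen_enumeration \<mu> A (-1) l u"

definition mds_map_pos ::
  "'a::metric_space measure \<Rightarrow> (nat \<Rightarrow> real) \<Rightarrow> (nat \<Rightarrow> 'a \<Rightarrow> real) \<Rightarrow> 'a \<Rightarrow> nat \<Rightarrow> real" where
  "mds_map_pos \<mu> l u x = (\<lambda>j. sqrt (l j) * continuous_rep \<mu> (l j) (u j) x)"

definition mds_map_neg ::
  "'a::metric_space measure \<Rightarrow> (nat \<Rightarrow> real) \<Rightarrow> (nat \<Rightarrow> 'a \<Rightarrow> real) \<Rightarrow> 'a \<Rightarrow> nat \<Rightarrow> real" where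
  "mds_map_neg \<mu> l u x = (\<lambda>j. sqrt (l j) * continuous_rep \<mu> (- l j) (u j) x)"

definition ell2 :: "(nat \<Rightarrow> real) set" where
  "ell2 = {a. summable (\<lambda>j. (a j)\<^sup>2)}"

definition ell2_inner :: "(nat \<Rightarrow> real) \<Rightarrow> (nat \<Rightarrow> real) \<Rightarrow> real" where
  "ell2_inner a b = (\<Sum>j. a j * b j)"

definition ell2_norm :: "(nat \<Rightarrow> real) \<Rightarrow> real" where
  "ell2_norm a = sqrt (\<Sum>j. (a j)\<^sup>2)"

definition krein_space :: "((nat \<Rightarrow> real) \<times> (nat \<Rightarrow> real)) set" where
  "krein_space = ell2 \<times> ell2"

definition krein_inner ::
  "(nat \<Rightarrow> real) \<times> (nat \<Rightarrow> real) \<Rightarrow> (nat \<Rightarrow> real) \<times> (nat \<Rightarrow> real) \<Rightarrow> real" where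
  "krein_inner p q = ell2_inner (fst p) (fst q) - ell2_inner (snd p) (snd q)"

definition krein_norm_sq :: "(nat \<Rightarrow> real) \<times> (nat \<Rightarrow> real) \<Rightarrow> real" where
  "krein_norm_sq p = (ell2_norm (fst p))\<^sup>2 - (ell2_norm (snd p))\<^sup>2"

lemma krein_norm_sq_eq_inner:
  assumes "p \<in> krein_space"
  shows "krein_norm_sq p = krein_inner p p"
  using assms
  by (auto simp: krein_norm_sq_def krein_inner_def krein_space_def ell2_def ell2_norm_def
      ell2_inner_def suminf_nonneg simp flip: power2_eq_square)

end

theory Submission
  imports Defs
begin

text \<open>
  Let \<open>h\<close> and \<open>h'\<close> be the normalised indicators of \<open>B\<^sub>r(x)\<close> and \<open>B\<^sub>r(y)\<close>. By Parseval,
  \<open>(h, T h') = \<Sum>\<^sub>i \<lambda>\<^sub>i (h, u\<^sub>i) (h', u\<^sub>i)\<close>. As \<open>r \<rightarrow> 0\<close>, the left side tends to \<open>k\<^sub>T(x, y)\<close> by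
  continuity, and each summand to \<open>\<lambda>\<^sub>i u\<^sub>i(x) u\<^sub>i(y)\<close>. The summands are dominated by averages of
  \<open>|\<lambda>\<^sub>i| u\<^sub>i\<^sup>2\<close>, whose total mass is at most the average of \<open>f\<close> and so does not exceed \<open>f(x)\<close> or \<open>f(y)\<close>
  in the limit at Lebesgue points. Hence \<open>k\<^sub>T(x, y) = \<Sum>\<^sub>i \<lambda>\<^sub>i u\<^sub>i(x) u\<^sub>i(y)\<close> at any two Lebesgue points,
  the diagonal included, and \<open>d\<^sup>2(x, y) = k\<^sub>T(x, x) + k\<^sub>T(y, y) - 2 k\<^sub>T(x, y) = \<Sum>\<^sub>i \<lambda>\<^sub>i (u\<^sub>i(x) - u\<^sub>i(y))\<^sup>2\<close>.
  For \<open>t \<noteq> 0\<close>, the terms with \<open>\<lambda>\<^sub>i = t\<close> add up to \<open>1 / t\<close> times the squared norm of the projection of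
  \<open>k\<^sub>T(x, \<cdot>) - k\<^sub>T(y, \<cdot>)\<close> to the eigenspace, so they may be replaced by any other eigenfunctions enumerated
  with multiplicity.
\<close>

section \<open>Sums over fibres and dominated convergence for unordered sums\<close>

text \<open>Completing \<open>F\<close> to full fibres of \<open>q\<close> can only increase a sum
  of nonnegative terms. Each full fibre is then traded for the fibre of \<open>p\<close> over the
  same value, and what remains is a finite partial sum of \<open>a\<close>. This is one half of
  \<open>has_sum_fibres\<close>, which applies it in both directions.\<close>

lemma sum_le_has_sum_fibres:
  fixes a :: "'i \<Rightarrow> real" and b :: "'j \<Rightarrow> real" and p :: "'i \<Rightarrow> 'k" and q :: "'j \<Rightarrow> 'k"
  assumes a: "(a has_sum V) A"
    and nonneg: "\<And>i. i \<in> A \<Longrightarrow> 0 \<le> a i" "\<And>j. j \<in> B \<Longrightarrow> 0 \<le> b j"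
    and finA: "\<And>t. t \<in> q ` B \<Longrightarrow> finite {i \<in> A. p i = t}"
    and finB: "\<And>t. t \<in> q ` B \<Longrightarrow> finite {j \<in> B. q j = t}"
    and eq: "\<And>t. t \<in> q ` B \<Longrightarrow>
      (\<Sum>i | i \<in> A \<and> p i = t. a i) = (\<Sum>j | j \<in> B \<and> q j = t. b j)"
    and F: "finite F" "F \<subseteq> B"
  shows "sum b F \<le> V"
proof -
  have mem: "t \<in> q ` B" if "t \<in> q ` F" for t using that F by auto
  have "sum b F = (\<Sum>t\<in>q ` F. \<Sum>j | j \<in> F \<and> q j = t. b j)"
    using F by (simp add: sum.image_gen)
  also have "\<dots> \<le> (\<Sum>t\<in>q ` F. \<Sum>j | j \<in> B \<and> q j = t. b j)"
    by (intro sum_mono sum_mono2) (use F nonneg finB mem in auto)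
  also have "\<dots> = (\<Sum>t\<in>q ` F. \<Sum>i | i \<in> A \<and> p i = t. a i)"
    using eq mem by simp
  also have "\<dots> = sum a (\<Union>t\<in>q ` F. {i \<in> A. p i = t})"
    by (subst sum.UNION_disjoint) (use F finA mem in auto)
  also have "\<dots> \<le> V"
    by (rule finite_sum_le_has_sum[OF a]) (use F finA mem nonneg in auto)
  finally show ?thesis .
qed

text \<open>For nonnegative terms the sum is the supremum of the finite partial sums, so the
  one-sided bound with the roles of \<open>a\<close> and \<open>b\<close> exchanged gives equality.
  It serves to exchange two systems of eigenfunctions whose index sets match only eigenvalue by
  eigenvalue, without a bijection between them.\<close>

lemma has_sum_fibres:
  fixes a :: "'i \<Rightarrow> real" and b :: "'j \<Rightarrow> real" and p :: "'i \<Rightarrow> 'k" and q :: "'j \<Rightarrow> 'k"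
  assumes a: "(a has_sum V) A"
    and nonneg: "\<And>i. i \<in> A \<Longrightarrow> 0 \<le> a i" "\<And>j. j \<in> B \<Longrightarrow> 0 \<le> b j"
    and finA: "\<And>t. t \<in> p ` A \<union> q ` B \<Longrightarrow> finite {i \<in> A. p i = t}"
    and finB: "\<And>t. t \<in> p ` A \<union> q ` B \<Longrightarrow> finite {j \<in> B. q j = t}"
    and eq: "\<And>t. t \<in> p ` A \<union> q ` B \<Longrightarrow>
      (\<Sum>i | i \<in> A \<and> p i = t. a i) = (\<Sum>j | j \<in> B \<and> q j = t. b j)"
  shows "(b has_sum V) B"
proof -
  have bV: "sum b F \<le> V" if "finite F" "F \<subseteq> B" for F
    by (rule sum_le_has_sum_fibres[where q = q and p = p, OF a]) (use assms that in auto)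
  have "b summable_on B"
    by (rule nonneg_bdd_above_summable_on) (use nonneg bV in \<open>auto intro!: bdd_aboveI2\<close>)
  then obtain W where W: "(b has_sum W) B"
    by (auto simp: summable_on_def)
  have "W \<le> V"
    using has_sum_le_finite_sums[OF W bV] .
  moreover have "sum a F \<le> W" if "finite F" "F \<subseteq> A" for F
    by (rule sum_le_has_sum_fibres[where q = p and p = q, OF W]) (use assms that in auto)
  then have "V \<le> W"
    by (rule has_sum_le_finite_sums[OF a])
  ultimately show ?thesis
    using W by simp
qed

text \<open>The majorants may vary along the filter: only their total mass has to converge, as in Pratt's lemma.\<close>

lemma infsum_tendsto_dominated:
  fixes c p :: "'r \<Rightarrow> 'i \<Rightarrow> real"
  assumes c: "\<And>i. i \<in> I \<Longrightarrow> ((\<lambda>r. c r i) \<longlongrightarrow> c0 i) F"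
    and p: "\<And>i. i \<in> I \<Longrightarrow> ((\<lambda>r. p r i) \<longlongrightarrow> p0 i) F"
    and dom: "\<forall>\<^sub>F r in F. \<forall>i\<in>I. \<bar>c r i\<bar> \<le> p r i" and dom0: "\<And>i. i \<in> I \<Longrightarrow> \<bar>c0 i\<bar> \<le> p0 i"
    and sum_le: "\<forall>\<^sub>F r in F. \<forall>G. finite G \<longrightarrow> G \<subseteq> I \<longrightarrow> sum (p r) G \<le> P r"
    and P: "(P \<longlongrightarrow> P0) F" and p0: "(p0 has_sum P0) I"
    and S: "\<forall>\<^sub>F r in F. (c r has_sum S r) I" and S0: "(c0 has_sum S0) I"
  shows "(S \<longlongrightarrow> S0) F"
proof (rule tendstoI)
  fix e :: real assume "e > 0"
  \<comment> \<open>Five errors of size at most \<open>d\<close> add up in the end: the tail of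
    \<open>c0\<close>, the finite sum over \<open>K\<close>, and three from bounding the tail
    \<open>P r - sum (p r) K\<close> by that of \<open>p0\<close>.\<close>
  define d where "d = e / 8"
  have d: "d > 0" using \<open>e > 0\<close> by (simp add: d_def)
  obtain K where K: "finite K" "K \<subseteq> I" "dist (sum p0 K) P0 \<le> d"
    using has_sum_finite_approximation[OF p0 d] by blast
  \<comment> \<open>Stated for a general \<open>f\<close>, since it is needed for the limit
    \<open>c0\<close> with bound \<open>d\<close> and for each \<open>c r\<close> with bound
    \<open>P r - sum (p r) K\<close>.\<close>
  have tail: "\<bar>T - sum f K\<bar> \<le> D"
    if f: "(f has_sum T) I" and D: "\<And>G. finite G \<Longrightarrow> G \<subseteq> I - K \<Longrightarrow> (\<Sum>i\<in>G. \<bar>f i\<bar>) \<le> D"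
    for f :: "'i \<Rightarrow> real" and T D
  proof -
    have fK: "(f has_sum (T - sum f K)) (I - K)"
      using has_sum_Diff[OF f has_sum_finite[of K f]] K by auto
    have le: "sum f G \<le> D" "- sum f G \<le> D" if "finite G" "G \<subseteq> I - K" for G
      using D[OF that] sum_abs[of f G] by linarith+
    then have "T - sum f K \<le> D" "- (T - sum f K) \<le> D"
      using has_sum_le_finite_sums[OF fK le(1)] has_sum_le_finite_sums[OF has_sum_uminusI[OF fK], of D] le(2)
      by (auto simp: sum_negf)
    then show ?thesis by linarith
  qed
  have tail0: "\<bar>S0 - sum c0 K\<bar> \<le> d"
  proof (rule tail[OF S0])
    fix G assume G: "finite G" "G \<subseteq> I - K"
    have "(\<Sum>i\<in>G. \<bar>c0 i\<bar>) \<le> sum p0 G" by (intro sum_mono dom0) (use G in auto)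
    also have "\<dots> = sum p0 (G \<union> K) - sum p0 K"
      using G K by (subst sum.union_disjoint) auto
    also have "sum p0 (G \<union> K) \<le> P0"
      using dom0 G K by (intro finite_sum_le_has_sum[OF p0]) (auto intro: order_trans[OF abs_ge_zero])
    finally show "(\<Sum>i\<in>G. \<bar>c0 i\<bar>) \<le> d" using K by (auto simp: dist_real_def)
  qed
  have "((\<lambda>r. sum (c r) K) \<longlongrightarrow> sum c0 K) F" "((\<lambda>r. sum (p r) K) \<longlongrightarrow> sum p0 K) F"
    using c p K by (auto intro!: tendsto_sum)
  then have "\<forall>\<^sub>F r in F. dist (sum (c r) K) (sum c0 K) < d" "\<forall>\<^sub>F r in F. dist (sum (p r) K) (sum p0 K) < d"
      "\<forall>\<^sub>F r in F. dist (P r) P0 < d"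
    using P d by (auto dest: tendstoD)
  then show "\<forall>\<^sub>F r in F. dist (S r) S0 < e"
    using dom sum_le S
  proof eventually_elim
    case (elim r)
    have "\<bar>S r - sum (c r) K\<bar> \<le> P r - sum (p r) K"
    proof (rule tail)
      show "(c r has_sum S r) I" by fact
      fix G assume G: "finite G" "G \<subseteq> I - K"
      have "(\<Sum>i\<in>G. \<bar>c r i\<bar>) \<le> sum (p r) G" using elim G by (intro sum_mono) auto
      also have "\<dots> = sum (p r) (G \<union> K) - sum (p r) K"
        using G K by (subst sum.union_disjoint) auto
      also have "sum (p r) (G \<union> K) \<le> P r" using elim G K by auto
      finally show "(\<Sum>i\<in>G. \<bar>c r i\<bar>) \<le> P r - sum (p r) K" by simp
    qed
    then show "dist (S r) S0 < e"
      using elim(1,2,3) tail0 K(3) d unfolding dist_real_def d_def by linarith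
  qed
qed

section \<open>Square-integrable functions\<close>

lemma L2_mult_integrable:
  assumes "g \<in> L2 \<mu>" "h \<in> L2 \<mu>"
  shows "integrable \<mu> (\<lambda>x. g x * h x)"
proof (rule Bochner_Integration.integrable_bound[of _ "\<lambda>x. (g x)\<^sup>2 + (h x)\<^sup>2"])
  show "integrable \<mu> (\<lambda>x. (g x)\<^sup>2 + (h x)\<^sup>2)" "(\<lambda>x. g x * h x) \<in> borel_measurable \<mu>"
    using assms by (auto simp: L2_def)
  have "\<bar>a * b\<bar> \<le> a\<^sup>2 + b\<^sup>2" for a b :: real
    using sum_squares_bound[of a b] sum_squares_bound[of a "-b"] by (simp add: abs_le_iff)
  then show "AE x in \<mu>. norm (g x * h x) \<le> norm ((g x)\<^sup>2 + (h x)\<^sup>2)"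
    by (simp del: abs_mult)
qed

lemma L2_scale: "g \<in> L2 \<mu> \<Longrightarrow> (\<lambda>x. c * g x) \<in> L2 \<mu>"
  by (auto simp: L2_def power_mult_distrib)

lemma L2_zero: "(\<lambda>x. 0) \<in> L2 \<mu>"
  by (auto simp: L2_def)

lemma L2_add:
  assumes "g \<in> L2 \<mu>" "h \<in> L2 \<mu>"
  shows "(\<lambda>x. g x + h x) \<in> L2 \<mu>"
  using assms L2_mult_integrable[OF assms]
  by (auto simp: L2_def power2_sum mult.assoc)

lemma L2_diff:
  assumes "g \<in> L2 \<mu>" "h \<in> L2 \<mu>"
  shows "(\<lambda>x. g x - h x) \<in> L2 \<mu>"
  using L2_add[OF assms(1) L2_scale[OF assms(2), of "-1"]] by simp

lemma L2_sum:
  assumes "\<And>i. i \<in> F \<Longrightarrow> g i \<in> L2 \<mu>"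
  shows "(\<lambda>x. \<Sum>i\<in>F. g i x) \<in> L2 \<mu>"
  using assms by (induction F rule: infinite_finite_induct) (auto intro: L2_add L2_zero)

lemma L2_abs:
  assumes "g \<in> L2 \<mu>"
  shows "(\<lambda>x. \<bar>g x\<bar>) \<in> L2 \<mu>"
proof -
  have [measurable]: "g \<in> borel_measurable \<mu>" using assms by (simp add: L2_def)
  show ?thesis using assms by (simp add: L2_def)
qed

lemma L2_AE_bounded:
  assumes h: "h \<in> L2 \<mu>" and g: "g \<in> borel_measurable \<mu>" and "AE x in \<mu>. \<bar>g x\<bar> \<le> \<bar>h x\<bar>"
  shows "g \<in> L2 \<mu>"
  using assms unfolding L2_def
  by (auto intro!: Bochner_Integration.integrable_bound[of _ "\<lambda>x. (h x)\<^sup>2"] simp: abs_le_square_iff)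

text \<open>Completing the square in each coefficient, one index at a time; the cross terms vanish
  by orthogonality. The coefficients \<open>c\<close> are left free so that the same identity yields
  Bessel's inequality and the minimality of the Fourier coefficients.\<close>

lemma orthonormal_expansion:
  assumes u: "L2_orthonormal \<mu> I u" and F: "finite F" "F \<subseteq> I" and g: "g \<in> L2 \<mu>"
  shows "(\<integral>x. (g x - (\<Sum>i\<in>F. c i * u i x))\<^sup>2 \<partial>\<mu>) =
    (\<integral>x. (g x)\<^sup>2 \<partial>\<mu>) - (\<Sum>i\<in>F. (\<integral>x. g x * u i x \<partial>\<mu>)\<^sup>2) + (\<Sum>i\<in>F. (c i - (\<integral>x. g x * u i x \<partial>\<mu>))\<^sup>2)"
  using F
proof (induction F rule: finite_induct)
  case empty
  then show ?case by simp
next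
  case (insert k F)
  have L2u: "u i \<in> L2 \<mu>" if "i \<in> I" for i
    using u that by (auto simp: L2_orthonormal_def)
  define s where "s = (\<lambda>x. \<Sum>i\<in>F. c i * u i x)"
  have s: "s \<in> L2 \<mu>"
    unfolding s_def using insert L2u by (intro L2_sum L2_scale) auto
  have uk: "u k \<in> L2 \<mu>" using insert L2u by auto
  have int: "integrable \<mu> (\<lambda>x. (g x - s x)\<^sup>2)" "integrable \<mu> (\<lambda>x. g x * u k x)"
      "integrable \<mu> (\<lambda>x. s x * u k x)" "integrable \<mu> (\<lambda>x. u k x * u k x)"
    using L2_mult_integrable[OF L2_diff[OF g s] L2_diff[OF g s]]
    by (auto simp: power2_eq_square intro!: L2_mult_integrable g s uk)
  have su: "(\<integral>x. s x * u k x \<partial>\<mu>) = 0"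
  proof -
    have "(\<integral>x. s x * u k x \<partial>\<mu>) = (\<integral>x. (\<Sum>i\<in>F. c i * (u i x * u k x)) \<partial>\<mu>)"
      by (simp add: s_def sum_distrib_right mult.assoc)
    also have "\<dots> = (\<Sum>i\<in>F. c i * (\<integral>x. u i x * u k x \<partial>\<mu>))"
      using insert L2u by (subst Bochner_Integration.integral_sum)
        (auto intro!: L2_mult_integrable integrable_mult_right)
    also have "\<dots> = (\<Sum>i\<in>F. c i * 0)"
      using insert u by (intro sum.cong) (auto simp: L2_orthonormal_def subset_eq)
    finally show ?thesis by simp
  qed
  have "(\<integral>x. (g x - (\<Sum>i\<in>insert k F. c i * u i x))\<^sup>2 \<partial>\<mu>) =
      (\<integral>x. (g x - s x)\<^sup>2 - 2 * c k * (g x * u k x) + 2 * c k * (s x * u k x) + (c k)\<^sup>2 * (u k x * u k x) \<partial>\<mu>)"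
    using insert by (intro Bochner_Integration.integral_cong)
      (auto simp: s_def power2_eq_square algebra_simps)
  also have "\<dots> = (\<integral>x. (g x - s x)\<^sup>2 \<partial>\<mu>) - 2 * c k * (\<integral>x. g x * u k x \<partial>\<mu>) + (c k)\<^sup>2"
    using int su insert u
    by (simp add: Bochner_Integration.integral_add Bochner_Integration.integral_diff L2_orthonormal_def)
  also have "(\<integral>x. (g x - s x)\<^sup>2 \<partial>\<mu>) = (\<integral>x. (g x)\<^sup>2 \<partial>\<mu>) - (\<Sum>i\<in>F. (\<integral>x. g x * u i x \<partial>\<mu>)\<^sup>2)
      + (\<Sum>i\<in>F. (c i - (\<integral>x. g x * u i x \<partial>\<mu>))\<^sup>2)"
    using insert by (simp add: s_def)
  finally show ?case
    using insert by (simp add: power2_eq_square algebra_simps)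
qed

text \<open>Bessel's inequality bounds the partial sums from above. For the converse, the Fourier
  coefficients approximate at least as well as the arbitrary coefficients \<open>c\<close> supplied
  by the density of the span.\<close>

lemma parseval:
  assumes u: "L2_orthonormal_basis \<mu> I u" and g: "g \<in> L2 \<mu>"
  shows "((\<lambda>i. (\<integral>x. g x * u i x \<partial>\<mu>)\<^sup>2) has_sum (\<integral>x. (g x)\<^sup>2 \<partial>\<mu>)) I"
proof -
  let ?c = "\<lambda>i. \<integral>x. g x * u i x \<partial>\<mu>"
  have on: "L2_orthonormal \<mu> I u" using u by (simp add: L2_orthonormal_basis_def)
  have bessel: "(\<Sum>i\<in>F. (?c i)\<^sup>2) \<le> (\<integral>x. (g x)\<^sup>2 \<partial>\<mu>)" if "finite F" "F \<subseteq> I" for F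
  proof -
    have "0 \<le> (\<integral>x. (g x - (\<Sum>i\<in>F. ?c i * u i x))\<^sup>2 \<partial>\<mu>)" by simp
    then show ?thesis using orthonormal_expansion[OF on that g, of ?c] by simp
  qed
  have "(\<lambda>i. (?c i)\<^sup>2) summable_on I"
    by (rule nonneg_bdd_above_summable_on) (use bessel in \<open>auto intro!: bdd_aboveI2\<close>)
  then obtain V where V: "((\<lambda>i. (?c i)\<^sup>2) has_sum V) I"
    by (auto simp: summable_on_def)
  have "V \<le> (\<integral>x. (g x)\<^sup>2 \<partial>\<mu>)"
    using has_sum_le_finite_sums[OF V bessel] .
  moreover have "(\<integral>x. (g x)\<^sup>2 \<partial>\<mu>) \<le> V + e" if "e > 0" for e
  proof -
    obtain F c where F: "finite F" "F \<subseteq> I" "(\<integral>x. (g x - (\<Sum>i\<in>F. c i * u i x))\<^sup>2 \<partial>\<mu>) < e"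
      using u g \<open>e > 0\<close> unfolding L2_orthonormal_basis_def by blast
    have "(\<integral>x. (g x)\<^sup>2 \<partial>\<mu>) - (\<Sum>i\<in>F. (?c i)\<^sup>2) \<le> (\<integral>x. (g x - (\<Sum>i\<in>F. c i * u i x))\<^sup>2 \<partial>\<mu>)"
      unfolding orthonormal_expansion[OF on F(1,2) g] by (simp add: sum_nonneg)
    moreover have "(\<Sum>i\<in>F. (?c i)\<^sup>2) \<le> V"
      by (rule finite_sum_le_has_sum[OF V]) (use F in auto)
    ultimately show ?thesis using F(3) by linarith
  qed
  then have "(\<integral>x. (g x)\<^sup>2 \<partial>\<mu>) \<le> V" by (rule field_le_epsilon)
  ultimately show ?thesis using V by simp
qed

text \<open>Polarisation: four times a product is the square of the sum minus the square of the
  difference, applied both to the functions and to their coefficients.\<close>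

lemma parseval_inner:
  assumes u: "L2_orthonormal_basis \<mu> I u" and g: "g \<in> L2 \<mu>" and h: "h \<in> L2 \<mu>"
  shows "((\<lambda>i. (\<integral>x. g x * u i x \<partial>\<mu>) * (\<integral>x. h x * u i x \<partial>\<mu>)) has_sum (\<integral>x. g x * h x \<partial>\<mu>)) I"
proof -
  let ?c = "\<lambda>g i. \<integral>x. g x * u i x \<partial>\<mu>"
  have L2u: "u i \<in> L2 \<mu>" if "i \<in> I" for i
    using u that by (auto simp: L2_orthonormal_def L2_orthonormal_basis_def)
  have "((\<lambda>i. (?c (\<lambda>x. g x + h x) i)\<^sup>2 - (?c (\<lambda>x. g x - h x) i)\<^sup>2) has_sum
      ((\<integral>x. (g x + h x)\<^sup>2 \<partial>\<mu>) - (\<integral>x. (g x - h x)\<^sup>2 \<partial>\<mu>))) I"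
    using has_sum_add[OF parseval[OF u L2_add[OF g h]] has_sum_uminusI[OF parseval[OF u L2_diff[OF g h]]]]
    by simp
  then have "((\<lambda>i. 1/4 * ((?c (\<lambda>x. g x + h x) i)\<^sup>2 - (?c (\<lambda>x. g x - h x) i)\<^sup>2)) has_sum
      1/4 * ((\<integral>x. (g x + h x)\<^sup>2 \<partial>\<mu>) - (\<integral>x. (g x - h x)\<^sup>2 \<partial>\<mu>))) I"
    by (rule has_sum_cmult_right)
  also have "(\<integral>x. (g x + h x)\<^sup>2 \<partial>\<mu>) - (\<integral>x. (g x - h x)\<^sup>2 \<partial>\<mu>) = (\<integral>x. (g x + h x)\<^sup>2 - (g x - h x)\<^sup>2 \<partial>\<mu>)"
    using L2_add[OF g h] L2_diff[OF g h]
    by (intro Bochner_Integration.integral_diff[symmetric]) (auto simp: L2_def)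
  also have "(\<lambda>x. (g x + h x)\<^sup>2 - (g x - h x)\<^sup>2) = (\<lambda>x. 4 * (g x * h x))"
    by (auto simp: power2_eq_square algebra_simps)
  finally have "((\<lambda>i. 1/4 * ((?c (\<lambda>x. g x + h x) i)\<^sup>2 - (?c (\<lambda>x. g x - h x) i)\<^sup>2)) has_sum
      (\<integral>x. g x * h x \<partial>\<mu>)) I" by simp
  moreover have "1/4 * ((?c (\<lambda>x. g x + h x) i)\<^sup>2 - (?c (\<lambda>x. g x - h x) i)\<^sup>2) = ?c g i * ?c h i"
    if "i \<in> I" for i
    using L2_mult_integrable[OF g L2u[OF that]] L2_mult_integrable[OF h L2u[OF that]]
    by (simp add: algebra_simps power2_eq_square)
  ultimately show ?thesis
    by (simp cong: has_sum_cong)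
qed

section \<open>Integral operators with kernels of quadratic growth\<close>

locale mds_space = prob_space \<mu> for \<mu> :: "'a::polish_space measure" +
  fixes x0 :: 'a
  assumes sets_eq [measurable_cong]: "sets \<mu> = sets borel"
    and moment: "integrable \<mu> (\<lambda>y. dist x0 y ^ 4)"
begin

sublocale pair: pair_sigma_finite \<mu> \<mu> ..

lemma space_eq [simp]: "space \<mu> = UNIV"
  using sets_eq_imp_space_eq[OF sets_eq] by simp

lemma L2_const: "(\<lambda>x. c) \<in> L2 \<mu>"
  by (auto simp: L2_def)

lemma L2_integrable: "g \<in> L2 \<mu> \<Longrightarrow> integrable \<mu> g"
  using L2_mult_integrable[OF _ L2_const[of 1]] by simp

text \<open>The fourth moment makes this function square integrable. The summand 1 keeps it at least
  1, so that \<open>weight x * weight y\<close> also dominates each factor alone and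
  constants.\<close>

definition weight :: "'a \<Rightarrow> real" where
  "weight x = 1 + (dist x0 x)\<^sup>2"

lemma weight_ge_1: "1 \<le> weight x"
  by (simp add: weight_def)

lemma weight_measurable [measurable]: "weight \<in> borel_measurable borel"
  unfolding weight_def by measurable

lemma weight_L2: "weight \<in> L2 \<mu>"
proof -
  have sq: "(\<lambda>y. (dist x0 y)\<^sup>2) \<in> L2 \<mu>"
    using moment by (simp add: L2_def flip: power_mult)
  show ?thesis
    unfolding weight_def by (rule L2_add[OF L2_const sq])
qed

text \<open>The bound implies square integrability for the product measure, hence the
  Hilbert-Schmidt property. As it holds at every point, every section is in \<open>L2 \<mu>\<close>
  and \<open>Op\<close> makes sense pointwise, not merely almost everywhere.\<close>

definition growth_kernel :: "('a \<Rightarrow> 'a \<Rightarrow> real) \<Rightarrow> bool" where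
  "growth_kernel \<kappa> \<longleftrightarrow> case_prod \<kappa> \<in> borel_measurable (borel \<Otimes>\<^sub>M borel) \<and>
     (\<exists>C\<ge>0. \<forall>x y. \<bar>\<kappa> x y\<bar> \<le> C * (weight x * weight y))"

definition Op :: "('a \<Rightarrow> 'a \<Rightarrow> real) \<Rightarrow> ('a \<Rightarrow> real) \<Rightarrow> 'a \<Rightarrow> real" where
  "Op \<kappa> g x = (\<integral>y. \<kappa> x y * g y \<partial>\<mu>)"

lemma growth_kernel_measurable:
  "growth_kernel \<kappa> \<Longrightarrow> case_prod \<kappa> \<in> borel_measurable (borel \<Otimes>\<^sub>M borel)"
  by (simp add: growth_kernel_def)

lemma growth_kernel_section_L2:
  assumes "growth_kernel \<kappa>"
  shows "\<kappa> x \<in> L2 \<mu>"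
proof -
  obtain C where C: "C \<ge> 0" "\<And>x y. \<bar>\<kappa> x y\<bar> \<le> C * (weight x * weight y)"
    using assms by (auto simp: growth_kernel_def)
  note [measurable] = growth_kernel_measurable[OF assms]
  have "\<kappa> x \<in> borel_measurable \<mu>" by measurable
  moreover have "\<bar>\<kappa> x y\<bar> \<le> \<bar>C * weight x * weight y\<bar>" for y
    using C(2)[of x y] by (simp add: mult.assoc)
  ultimately show ?thesis
    by (auto intro: L2_AE_bounded[OF L2_scale[OF weight_L2, of "C * weight x"]])
qed

lemma Op_measurable:
  assumes "growth_kernel \<kappa>" and "g \<in> L2 \<mu>"
  shows "Op \<kappa> g \<in> borel_measurable \<mu>"
proof -
  note [measurable] = growth_kernel_measurable[OF assms(1)]
  have [measurable]: "g \<in> borel_measurable borel"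
    using assms(2) by (simp add: L2_def cong: measurable_cong_sets[OF sets_eq])
  show ?thesis unfolding Op_def by measurable
qed

lemma Op_bound:
  assumes C: "\<And>y. \<bar>\<kappa> x y\<bar> \<le> C * (weight x * weight y)" and g: "g \<in> L2 \<mu>"
  shows "\<bar>Op \<kappa> g x\<bar> \<le> C * weight x * (\<integral>y. weight y * \<bar>g y\<bar> \<partial>\<mu>)"
proof -
  have g': "(\<lambda>y. \<bar>g y\<bar>) \<in> L2 \<mu>" using g by (rule L2_abs)
  have "\<bar>Op \<kappa> g x\<bar> \<le> (\<integral>y. \<bar>\<kappa> x y * g y\<bar> \<partial>\<mu>)"
    unfolding Op_def by (rule integral_abs_bound)
  also have "\<dots> \<le> (\<integral>y. C * weight x * (weight y * \<bar>g y\<bar>) \<partial>\<mu>)"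
  proof (rule integral_mono')
    show "integrable \<mu> (\<lambda>y. C * weight x * (weight y * \<bar>g y\<bar>))"
      by (intro integrable_mult_right L2_mult_integrable weight_L2 g')
    show le: "\<bar>\<kappa> x y * g y\<bar> \<le> C * weight x * (weight y * \<bar>g y\<bar>)" for y
      using mult_right_mono[OF C[of y] abs_ge_zero[of "g y"]] by (simp add: abs_mult mult_ac)
    show "0 \<le> C * weight x * (weight y * \<bar>g y\<bar>)" for y
      using le[of y] by linarith
  qed
  finally show ?thesis by simp
qed

lemma Op_L2:
  assumes "growth_kernel \<kappa>" and g: "g \<in> L2 \<mu>"
  shows "Op \<kappa> g \<in> L2 \<mu>"
proof -
  obtain C where C: "C \<ge> 0" "\<And>x y. \<bar>\<kappa> x y\<bar> \<le> C * (weight x * weight y)"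
    using assms by (auto simp: growth_kernel_def)
  define D where "D = C * (\<integral>y. weight y * \<bar>g y\<bar> \<partial>\<mu>)"
  have "\<bar>Op \<kappa> g x\<bar> \<le> \<bar>D * weight x\<bar>" for x
    using Op_bound[where \<kappa>=\<kappa> and x=x, OF C(2) g] by (simp add: D_def mult_ac)
  then show ?thesis
    by (auto intro: L2_AE_bounded[OF L2_scale[OF weight_L2, of D] Op_measurable[OF assms]])
qed

text \<open>The growth bound gives a majorant \<open>G x * H y\<close> with \<open>G\<close> and
  \<open>H\<close> integrable, so the integrand is integrable on the product and the order of
  integration may be exchanged.\<close>

lemma Op_Fubini:
  assumes "growth_kernel \<kappa>" and g: "g \<in> L2 \<mu>" and h: "h \<in> L2 \<mu>"
  shows "(\<integral>x. g x * Op \<kappa> h x \<partial>\<mu>) = (\<integral>y. Op (\<lambda>y x. \<kappa> x y) g y * h y \<partial>\<mu>)"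
proof -
  obtain C where C: "C \<ge> 0" "\<And>x y. \<bar>\<kappa> x y\<bar> \<le> C * (weight x * weight y)"
    using assms by (auto simp: growth_kernel_def)
  note [measurable] = growth_kernel_measurable[OF assms(1)]
  have [measurable]: "g \<in> borel_measurable borel" "h \<in> borel_measurable borel"
    using g h by (simp_all add: L2_def cong: measurable_cong_sets[OF sets_eq])
  define G where "G x = weight x * \<bar>g x\<bar>" for x
  define H where "H x = C * (weight x * \<bar>h x\<bar>)" for x
  have [measurable]: "G \<in> borel_measurable borel" "H \<in> borel_measurable borel"
    unfolding G_def H_def by measurable
  have abs_L2: "(\<lambda>y. \<bar>g y\<bar>) \<in> L2 \<mu>" "(\<lambda>y. \<bar>h y\<bar>) \<in> L2 \<mu>" using g h by (auto intro: L2_abs)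
  have GH: "integrable \<mu> G" "integrable \<mu> H"
    unfolding G_def H_def by (intro integrable_mult_right L2_mult_integrable weight_L2 abs_L2)+
  have "integrable (\<mu> \<Otimes>\<^sub>M \<mu>) (\<lambda>(x, y). G x * H y)"
  proof (rule pair.Fubini_integrable)
    show "(\<lambda>(x, y). G x * H y) \<in> borel_measurable (\<mu> \<Otimes>\<^sub>M \<mu>)" by measurable
    show "integrable \<mu> (\<lambda>x. \<integral>y. norm (case (x, y) of (x, y) \<Rightarrow> G x * H y) \<partial>\<mu>)"
      using GH by (simp add: abs_mult)
    show "AE x in \<mu>. integrable \<mu> (\<lambda>y. case (x, y) of (x, y) \<Rightarrow> G x * H y)"
      using GH by simp
  qed
  then have int: "integrable (\<mu> \<Otimes>\<^sub>M \<mu>) (\<lambda>(x, y). \<kappa> x y * (g x * h y))"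
  proof (rule Bochner_Integration.integrable_bound)
    show "(\<lambda>(x, y). \<kappa> x y * (g x * h y)) \<in> borel_measurable (\<mu> \<Otimes>\<^sub>M \<mu>)" by measurable
    have "\<bar>\<kappa> x y\<bar> * (\<bar>g x\<bar> * \<bar>h y\<bar>) \<le> \<bar>G x * H y\<bar>" for x y
    proof -
      have "\<bar>\<kappa> x y\<bar> * (\<bar>g x\<bar> * \<bar>h y\<bar>) \<le> C * (weight x * weight y) * (\<bar>g x\<bar> * \<bar>h y\<bar>)"
        by (intro mult_right_mono C) auto
      also have "\<dots> = G x * H y" by (simp add: G_def H_def)
      finally show ?thesis by linarith
    qed
    then show "AE p in \<mu> \<Otimes>\<^sub>M \<mu>. norm (case p of (x, y) \<Rightarrow> \<kappa> x y * (g x * h y))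
        \<le> norm (case p of (x, y) \<Rightarrow> G x * H y)"
      by (auto simp: abs_mult)
  qed
  have "(\<integral>x. g x * Op \<kappa> h x \<partial>\<mu>) = (\<integral>x. (\<integral>y. \<kappa> x y * (g x * h y) \<partial>\<mu>) \<partial>\<mu>)"
    unfolding Op_def by (subst integral_mult_right_zero[symmetric]) (simp only: mult.left_commute)
  also have "\<dots> = (\<integral>y. (\<integral>x. \<kappa> x y * (g x * h y) \<partial>\<mu>) \<partial>\<mu>)"
    using pair.Fubini_integral[OF int] by simp
  also have "\<dots> = (\<integral>y. Op (\<lambda>y x. \<kappa> x y) g y * h y \<partial>\<mu>)"
    unfolding Op_def by (subst integral_mult_left_zero[symmetric]) (simp only: mult.assoc)
  finally show ?thesis .
qed

text \<open>Dominated convergence along a convergent sequence: its weights are bounded by some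
  \<open>D\<close>, which makes the majorant independent of the index.\<close>

lemma Op_continuous:
  assumes \<kappa>: "growth_kernel \<kappa>" and cont: "\<And>y. continuous_on UNIV (\<lambda>x. \<kappa> x y)" and g: "g \<in> L2 \<mu>"
  shows "continuous_on UNIV (Op \<kappa> g)"
  unfolding continuous_on_sequentially
proof (intro allI ballI impI, elim conjE)
  fix X :: "nat \<Rightarrow> 'a" and a assume X: "X \<longlonglongrightarrow> a"
  obtain C where C: "C \<ge> 0" "\<And>x y. \<bar>\<kappa> x y\<bar> \<le> C * (weight x * weight y)"
    using assms by (auto simp: growth_kernel_def)
  have "(\<lambda>n. weight (X n)) \<longlonglongrightarrow> weight a"
    unfolding weight_def by (intro tendsto_intros X)
  then have "Bseq (\<lambda>n. weight (X n))"
    by (intro convergent_imp_Bseq) (auto simp: convergent_def)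
  then obtain D where D: "\<And>n. \<bar>weight (X n)\<bar> \<le> D"
    by (auto simp: Bseq_def)
  have gm: "g \<in> borel_measurable \<mu>" and gL: "(\<lambda>y. \<bar>g y\<bar>) \<in> L2 \<mu>" using g L2_abs by (auto simp: L2_def[of \<mu>])
  have sm: "\<kappa> x \<in> borel_measurable \<mu>" for x
    using growth_kernel_section_L2[OF \<kappa>] by (simp add: L2_def)
  have "(\<lambda>n. Op \<kappa> g (X n)) \<longlonglongrightarrow> Op \<kappa> g a"
    unfolding Op_def
  proof (rule integral_dominated_convergence[where w = "\<lambda>y. C * D * (weight y * \<bar>g y\<bar>)"])
    show "integrable \<mu> (\<lambda>y. C * D * (weight y * \<bar>g y\<bar>))"
      by (intro integrable_mult_right L2_mult_integrable weight_L2 gL)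
    show "AE y in \<mu>. (\<lambda>n. \<kappa> (X n) y * g y) \<longlonglongrightarrow> \<kappa> a y * g y"
      using cont X by (auto intro!: tendsto_intros simp: continuous_on_sequentially o_def)
    show "AE y in \<mu>. norm (\<kappa> (X n) y * g y) \<le> C * D * (weight y * \<bar>g y\<bar>)" for n
    proof (rule AE_I2)
      fix y
      have "\<bar>\<kappa> (X n) y\<bar> * \<bar>g y\<bar> \<le> C * (weight (X n) * weight y) * \<bar>g y\<bar>"
        by (intro mult_right_mono C) auto
      also have "\<dots> \<le> C * (D * weight y) * \<bar>g y\<bar>"
        using D[of n] C(1) weight_ge_1[of y] by (intro mult_right_mono mult_left_mono) auto
      finally show "norm (\<kappa> (X n) y * g y) \<le> C * D * (weight y * \<bar>g y\<bar>)"
        by (simp add: abs_mult mult_ac)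
    qed
  qed (use gm sm in auto)
  then show "(Op \<kappa> g \<circ> X) \<longlonglongrightarrow> Op \<kappa> g a" by (simp add: o_def)
qed

lemma Op_sum:
  assumes "growth_kernel \<kappa>" and "\<And>i. i \<in> F \<Longrightarrow> g i \<in> L2 \<mu>"
  shows "Op \<kappa> (\<lambda>y. \<Sum>i\<in>F. c i * g i y) x = (\<Sum>i\<in>F. c i * Op \<kappa> (g i) x)"
proof -
  have "Op \<kappa> (\<lambda>y. \<Sum>i\<in>F. c i * g i y) x = (\<integral>y. (\<Sum>i\<in>F. c i * (\<kappa> x y * g i y)) \<partial>\<mu>)"
    by (simp add: Op_def sum_distrib_left mult_ac)
  also have "\<dots> = (\<Sum>i\<in>F. c i * Op \<kappa> (g i) x)"
    using assms by (subst Bochner_Integration.integral_sum)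
      (auto simp: Op_def intro!: integrable_mult_right L2_mult_integrable[OF growth_kernel_section_L2])
  finally show ?thesis .
qed

section \<open>The MDS kernels\<close>

lemma mds_kernel_commute: "mds_kernel x y = mds_kernel y x"
  by (simp add: mds_kernel_def dist_commute)

lemma mds_kernel_growth: "growth_kernel mds_kernel"
  unfolding growth_kernel_def
proof (intro conjI exI[of _ 1] allI)
  show "case_prod mds_kernel \<in> borel_measurable (borel \<Otimes>\<^sub>M (borel :: 'a measure))"
    unfolding mds_kernel_def by measurable
  fix x y :: 'a
  have "dist x y \<le> dist x0 x + dist x0 y"
    by (metis dist_commute dist_triangle)
  then have "(dist x y)\<^sup>2 \<le> (dist x0 x + dist x0 y)\<^sup>2" by (intro power_mono) auto
  \<comment> \<open>The factor 2 is absorbed by the 1/2 in the kernel, which is why the growth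
    constant is 1.\<close>
  also have "\<dots> \<le> 2 * ((dist x0 x)\<^sup>2 + (dist x0 y)\<^sup>2)"
    using sum_squares_bound[of "dist x0 x" "dist x0 y"] by (simp add: power2_sum)
  also have "\<dots> \<le> 2 * (weight x * weight y)"
    by (simp add: weight_def algebra_simps)
  finally show "\<bar>mds_kernel x y\<bar> \<le> 1 * (weight x * weight y)"
    by (simp add: mds_kernel_def)
qed auto

lemma mds_kernel_continuous: "continuous_on UNIV (\<lambda>x. mds_kernel x y)"
  unfolding mds_kernel_def by (intro continuous_intros)

text \<open>By symmetry of the kernel this one function accounts for both single integrals in
  \<open>mds_kernel_T\<close>, and its mean for the double integral.\<close>

definition mean_kernel :: "'a \<Rightarrow> real" where
  "mean_kernel x = (\<integral>y. mds_kernel x y \<partial>\<mu>)"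

lemma mean_kernel_eq_Op: "mean_kernel = Op mds_kernel (\<lambda>y. 1)"
  by (auto simp: mean_kernel_def Op_def)

lemma mean_kernel_L2: "mean_kernel \<in> L2 \<mu>"
  unfolding mean_kernel_eq_Op by (rule Op_L2[OF mds_kernel_growth L2_const])

lemma mean_kernel_continuous: "continuous_on UNIV mean_kernel"
  unfolding mean_kernel_eq_Op
  by (rule Op_continuous[OF mds_kernel_growth mds_kernel_continuous L2_const])

lemma mean_kernel_eq: "(\<integral>x. mds_kernel x y \<partial>\<mu>) = mean_kernel y"
  using mds_kernel_commute[of _ y] by (simp add: mean_kernel_def)

lemma mds_kernel_T_eq:
  "mds_kernel_T \<mu> x y = mds_kernel x y - mean_kernel x - mean_kernel y + (\<integral>z. mean_kernel z \<partial>\<mu>)"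
  by (simp add: mds_kernel_T_def mean_kernel_eq flip: mean_kernel_def)

lemma mds_kernel_T_commute: "mds_kernel_T \<mu> x y = mds_kernel_T \<mu> y x"
  by (simp add: mds_kernel_T_eq mds_kernel_commute)

text \<open>The centring terms cancel in this combination, and \<open>mds_kernel\<close> vanishes on
  the diagonal; only \<open>-2 * mds_kernel x y\<close> survives.\<close>

lemma dist_sq_eq:
  "(dist x y)\<^sup>2 = mds_kernel_T \<mu> x x + mds_kernel_T \<mu> y y - 2 * mds_kernel_T \<mu> x y"
  by (simp add: mds_kernel_T_eq mds_kernel_def)

text \<open>The mean kernel grows at most like \<open>D * weight\<close>. Since weights are at least
  1, the terms in one variable and the constant are absorbed into the product of the
  weights.\<close>

lemma mds_kernel_T_growth: "growth_kernel (mds_kernel_T \<mu>)"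
proof -
  obtain C where C: "C \<ge> 0" "\<And>x y. \<bar>mds_kernel x y\<bar> \<le> C * (weight x * weight y)"
    using mds_kernel_growth by (auto simp: growth_kernel_def)
  define D where "D = C * (\<integral>y. weight y \<partial>\<mu>)"
  define e where "e = \<bar>\<integral>z. mean_kernel z \<partial>\<mu>\<bar>"
  have "0 \<le> (\<integral>y. weight y \<partial>\<mu>)"
    using weight_ge_1 by (intro Bochner_Integration.integral_nonneg) (auto intro: order_trans[OF zero_le_one])
  then have D0: "D \<ge> 0" using C(1) by (simp add: D_def)
  have m: "\<bar>mean_kernel x\<bar> \<le> D * weight x" for x
    using Op_bound[of mds_kernel x C, OF C(2) L2_const[of 1]] by (simp add: mean_kernel_eq_Op D_def mult_ac)
  have [measurable]: "mean_kernel \<in> borel_measurable borel"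
    using mean_kernel_continuous by (rule borel_measurable_continuous_onI)
  note [measurable] = growth_kernel_measurable[OF mds_kernel_growth]
  show ?thesis
    unfolding growth_kernel_def
  proof (intro conjI exI[of _ "C + 2 * D + e"] allI)
    show "(\<lambda>(x, y). mds_kernel_T \<mu> x y) \<in> borel_measurable (borel \<Otimes>\<^sub>M borel)"
      unfolding mds_kernel_T_eq by measurable
    show "0 \<le> C + 2 * D + e" using C(1) D0 by (simp add: e_def)
    fix x y
    have w: "weight x \<le> weight x * weight y" "weight y \<le> weight x * weight y" "1 \<le> weight x * weight y"
      using weight_ge_1[of x] weight_ge_1[of y] mult_mono[of 1 "weight x" 1 "weight y"]
      by (auto simp: mult_le_cancel_left1 mult_le_cancel_right1)
    have "\<bar>mds_kernel_T \<mu> x y\<bar> \<le> \<bar>mds_kernel x y\<bar> + \<bar>mean_kernel x\<bar> + \<bar>mean_kernel y\<bar> + e"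
      unfolding mds_kernel_T_eq e_def by linarith
    also have "\<dots> \<le> C * (weight x * weight y) + D * weight x + D * weight y + e"
      using C(2)[of x y] m[of x] m[of y] by linarith
    also have "\<dots> \<le> C * (weight x * weight y) + D * (weight x * weight y) + D * (weight x * weight y)
        + e * (weight x * weight y)"
      using mult_left_mono[OF w(1) D0] mult_left_mono[OF w(2) D0] mult_left_mono[OF w(3), of e]
      by (simp add: e_def)
    finally show "\<bar>mds_kernel_T \<mu> x y\<bar> \<le> (C + 2 * D + e) * (weight x * weight y)"
      by (simp add: algebra_simps)
  qed
qed

text \<open>Joint continuity at \<open>(x, y)\<close>, phrased with one radius for both variables
  because the averages below run over a ball around \<open>x\<close> and a ball around
  \<open>y\<close>.\<close>

lemma mds_kernel_T_near:
  assumes "e > 0"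
  obtains d where "d > 0"
    "\<And>z w. dist x z < d \<Longrightarrow> dist y w < d \<Longrightarrow> \<bar>mds_kernel_T \<mu> z w - mds_kernel_T \<mu> x y\<bar> < e"
proof -
  have "continuous_on UNIV (\<lambda>p. mds_kernel_T \<mu> (fst p) (snd p))"
    unfolding mds_kernel_T_eq mds_kernel_def
    by (intro continuous_intros continuous_on_compose2[OF mean_kernel_continuous]) auto
  from this[unfolded continuous_on_iff, rule_format, of "(x, y)" e] assms
  obtain d where d: "d > 0" "\<And>q. dist q (x, y) < d \<Longrightarrow>
      dist (mds_kernel_T \<mu> (fst q) (snd q)) (mds_kernel_T \<mu> x y) < e"
    by auto
  show ?thesis
  proof
    \<comment> \<open>Halving suffices because the distance of pairs is at most the sum of the
      distances of the components.\<close>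
    show "d / 2 > 0" using d by simp
    fix z w assume zw: "dist x z < d / 2" "dist y w < d / 2"
    have "dist (z, w) (x, y) \<le> dist z x + dist w y"
      unfolding dist_Pair_Pair by (rule sqrt_sum_squares_le_sum) auto
    then show "\<bar>mds_kernel_T \<mu> z w - mds_kernel_T \<mu> x y\<bar> < e"
      using d(2)[of "(z, w)"] zw by (simp add: dist_real_def dist_commute)
  qed
qed

lemma Op_T_continuous:
  assumes "g \<in> L2 \<mu>"
  shows "continuous_on UNIV (Op (mds_kernel_T \<mu>) g)"
proof (rule Op_continuous[OF mds_kernel_T_growth _ assms])
  show "continuous_on UNIV (\<lambda>x. mds_kernel_T \<mu> x y)" for y
    unfolding mds_kernel_T_eq by (intro continuous_intros mds_kernel_continuous mean_kernel_continuous)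
qed

lemma Op_T_selfadjoint:
  assumes "g \<in> L2 \<mu>" and "h \<in> L2 \<mu>"
  shows "(\<integral>x. g x * Op (mds_kernel_T \<mu>) h x \<partial>\<mu>) = (\<integral>x. Op (mds_kernel_T \<mu>) g x * h x \<partial>\<mu>)"
proof -
  have "(\<lambda>y x. mds_kernel_T \<mu> x y) = mds_kernel_T \<mu>"
    by (intro ext) (rule mds_kernel_T_commute)
  then show ?thesis using Op_Fubini[OF mds_kernel_T_growth assms] by simp
qed

text \<open>All terms of \<open>PKP\<close> unfold by linearity except the mean of
  \<open>Op mds_kernel g\<close>, which Fubini against the constant 1 turns into the integral of
  \<open>mean_kernel y * g y\<close>. The equality holds at every point.\<close>

lemma mds_T_eq:
  assumes g: "g \<in> L2 \<mu>"
  shows "mds_T \<mu> g = Op (mds_kernel_T \<mu>) g"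
proof
  fix x
  define c where "c = (\<integral>y. g y \<partial>\<mu>)"
  have ig: "integrable \<mu> g" using L2_integrable[OF g] .
  have ik: "integrable \<mu> (\<lambda>y. mds_kernel z y * g y)" "integrable \<mu> (mds_kernel z)" for z
    using L2_mult_integrable[OF growth_kernel_section_L2[OF mds_kernel_growth] g]
      L2_integrable[OF growth_kernel_section_L2[OF mds_kernel_growth]] by auto
  have im: "integrable \<mu> (\<lambda>y. mean_kernel y * g y)" "integrable \<mu> mean_kernel"
    using L2_mult_integrable[OF mean_kernel_L2 g] L2_integrable[OF mean_kernel_L2] by auto
  have K: "mds_K \<mu> (mds_P \<mu> g) z = Op mds_kernel g z - c * mean_kernel z" for z
    using ik[of z] by (simp add: mds_K_def mds_P_def right_diff_distrib c_def Op_def mean_kernel_def)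
  have "(\<integral>z. Op mds_kernel g z \<partial>\<mu>) = (\<integral>y. mean_kernel y * g y \<partial>\<mu>)"
    using Op_Fubini[OF mds_kernel_growth L2_const[of 1] g]
    by (simp add: Op_def mean_kernel_eq)
  then have "mds_T \<mu> g x = Op mds_kernel g x - c * mean_kernel x
      - ((\<integral>y. mean_kernel y * g y \<partial>\<mu>) - c * (\<integral>z. mean_kernel z \<partial>\<mu>))"
    using L2_integrable[OF Op_L2[OF mds_kernel_growth g]] im
    by (simp add: mds_T_def mds_P_def[of _ "mds_K \<mu> (mds_P \<mu> g)"] K)
  moreover have "Op (mds_kernel_T \<mu>) g x = (\<integral>y. mds_kernel x y * g y - mean_kernel x * g y
      - mean_kernel y * g y + (\<integral>z. mean_kernel z \<partial>\<mu>) * g y \<partial>\<mu>)"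
    by (simp add: Op_def mds_kernel_T_eq algebra_simps)
  ultimately show "mds_T \<mu> g x = Op (mds_kernel_T \<mu>) g x"
    using ig ik im by (simp add: Op_def c_def)
qed

section \<open>Continuous representatives and eigenspaces of the centred operator\<close>

lemma continuous_rep_eq_Op: "continuous_rep \<mu> l g x = 1 / l * Op (mds_kernel_T \<mu>) g x"
  by (simp add: continuous_rep_def Op_def)

lemma eigenspace_mds_T:
  "g \<in> eigenspace \<mu> (mds_T \<mu>) l \<longleftrightarrow> g \<in> L2 \<mu> \<and> (AE x in \<mu>. Op (mds_kernel_T \<mu>) g x = l * g x)"
  by (auto simp: eigenspace_def mds_T_eq)

text \<open>Self-adjointness moves the operator onto \<open>v\<close>. With \<open>v\<close> a basis
  function this gives the Fourier coefficients of the image of \<open>g\<close> that enter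
  Parseval's identity.\<close>

lemma eigenspace_inner:
  assumes v: "v \<in> eigenspace \<mu> (mds_T \<mu>) l" and g: "g \<in> L2 \<mu>"
  shows "(\<integral>x. Op (mds_kernel_T \<mu>) g x * v x \<partial>\<mu>) = l * (\<integral>x. g x * v x \<partial>\<mu>)"
proof -
  have v': "v \<in> L2 \<mu>" "AE x in \<mu>. Op (mds_kernel_T \<mu>) v x = l * v x"
    using v by (auto simp: eigenspace_mds_T)
  have m: "g \<in> borel_measurable \<mu>" "v \<in> borel_measurable \<mu>"
      "Op (mds_kernel_T \<mu>) v \<in> borel_measurable \<mu>"
    using g v' Op_L2[OF mds_kernel_T_growth v'(1)] by (auto simp: L2_def)
  have "(\<integral>x. Op (mds_kernel_T \<mu>) g x * v x \<partial>\<mu>) = (\<integral>x. g x * Op (mds_kernel_T \<mu>) v x \<partial>\<mu>)"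
    by (rule Op_T_selfadjoint[OF g v'(1), symmetric])
  also have "\<dots> = (\<integral>x. l * (g x * v x) \<partial>\<mu>)"
    using v' m by (intro integral_cong_AE) auto
  finally show ?thesis by simp
qed

lemma eigenspace_orthogonal:
  assumes "v \<in> eigenspace \<mu> (mds_T \<mu>) l" and "w \<in> eigenspace \<mu> (mds_T \<mu>) k" and "l \<noteq> k"
  shows "(\<integral>x. v x * w x \<partial>\<mu>) = 0"
proof -
  have "v \<in> L2 \<mu>" "w \<in> L2 \<mu>" using assms by (auto simp: eigenspace_mds_T)
  then have "l * (\<integral>x. w x * v x \<partial>\<mu>) = k * (\<integral>x. v x * w x \<partial>\<mu>)"
    using eigenspace_inner[OF assms(1), of w] eigenspace_inner[OF assms(2), of v] Op_T_selfadjoint[of v w]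
    by (simp add: mult.commute)
  then show ?thesis using assms(3) by (simp add: mult.commute)
qed

end

context mds_space
begin

section \<open>Averages over small balls\<close>

text \<open>If the ball is null, division by zero makes the whole function 0. Integrability
  therefore holds for all radii; only the normalisation to integral 1 requires positive
  measure.\<close>

definition ball_density :: "'a \<Rightarrow> real \<Rightarrow> 'a \<Rightarrow> real" where
  "ball_density x r z = indicator (ball x r) z / measure \<mu> (ball x r)"

lemma ball_density_measurable [measurable]: "ball_density x r \<in> borel_measurable borel"
  unfolding ball_density_def by (intro borel_measurable_divide borel_measurable_indicator) auto

lemma ball_density_nonneg: "0 \<le> ball_density x r z"
  by (simp add: ball_density_def)

lemma ball_density_mult_integrable:
  assumes "integrable \<mu> \<phi>"
  shows "integrable \<mu> (\<lambda>z. ball_density x r z * \<phi> z)"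
proof -
  have "integrable \<mu> (\<lambda>z. indicator (ball x r) z *\<^sub>R \<phi> z)"
    using assms by (intro integrable_mult_indicator) auto
  from integrable_mult_right[OF this, of "1 / measure \<mu> (ball x r)"] show ?thesis
    by (simp add: ball_density_def)
qed

lemma ball_density_L2: "ball_density x r \<in> L2 \<mu>"
  using ball_density_mult_integrable[OF ball_density_mult_integrable[of "\<lambda>z. 1" x r], of x r]
  by (simp add: L2_def power2_eq_square)

lemma ball_density_integral:
  assumes "measure \<mu> (ball x r) > 0"
  shows "(\<integral>z. ball_density x r z \<partial>\<mu>) = 1"
  using assms by (simp add: ball_density_def)

lemma ball_average_near:
  assumes pos: "measure \<mu> (ball x r) > 0"
    and int: "integrable \<mu> (\<lambda>z. ball_density x r z * \<phi> z)"
    and near: "\<And>z. dist x z < r \<Longrightarrow> \<bar>\<phi> z - c\<bar> \<le> e"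
  shows "\<bar>(\<integral>z. ball_density x r z * \<phi> z \<partial>\<mu>) - c\<bar> \<le> e"
proof -
  have int1: "integrable \<mu> (ball_density x r)"
    using L2_integrable[OF ball_density_L2] .
  have "(\<integral>z. ball_density x r z * (\<phi> z - c) \<partial>\<mu>) = (\<integral>z. ball_density x r z * \<phi> z \<partial>\<mu>) - c"
    using int int1 ball_density_integral[OF pos] by (simp add: right_diff_distrib)
  moreover have "\<bar>\<integral>z. ball_density x r z * (\<phi> z - c) \<partial>\<mu>\<bar> \<le> (\<integral>z. \<bar>ball_density x r z * (\<phi> z - c)\<bar> \<partial>\<mu>)"
    by (rule integral_abs_bound)
  moreover have "\<dots> \<le> (\<integral>z. ball_density x r z * e \<partial>\<mu>)"
  proof (rule integral_mono)
    show "integrable \<mu> (\<lambda>z. \<bar>ball_density x r z * (\<phi> z - c)\<bar>)"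
      using int int1 by (auto simp: right_diff_distrib)
    show "integrable \<mu> (\<lambda>z. ball_density x r z * e)" using int1 by auto
    show "\<bar>ball_density x r z * (\<phi> z - c)\<bar> \<le> ball_density x r z * e" for z
      using near[of z] mult_left_mono[OF near[of z] ball_density_nonneg[of x r z]]
      by (cases "dist x z < r") (auto simp: abs_mult ball_density_nonneg, simp add: ball_density_def)
  qed
  moreover have "(\<integral>z. ball_density x r z * e \<partial>\<mu>) = e"
    using ball_density_integral[OF pos] by simp
  ultimately show ?thesis by linarith
qed

text \<open>Jensen's inequality, obtained from the nonnegativity of the variance of \<open>g\<close>
  under the ball density.\<close>

lemma ball_average_square_le:
  assumes pos: "measure \<mu> (ball x r) > 0" and g: "g \<in> L2 \<mu>"
  shows "(\<integral>z. ball_density x r z * g z \<partial>\<mu>)\<^sup>2 \<le> (\<integral>z. ball_density x r z * (g z)\<^sup>2 \<partial>\<mu>)"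
proof -
  define a where "a = (\<integral>z. ball_density x r z * g z \<partial>\<mu>)"
  have int: "integrable \<mu> (ball_density x r)" "integrable \<mu> (\<lambda>z. ball_density x r z * g z)"
      "integrable \<mu> (\<lambda>z. ball_density x r z * (g z)\<^sup>2)"
    using g L2_integrable[OF ball_density_L2] L2_mult_integrable[OF ball_density_L2 g]
    by (auto simp: L2_def intro: ball_density_mult_integrable)
  have "0 \<le> (\<integral>z. ball_density x r z * (g z - a)\<^sup>2 \<partial>\<mu>)"
    by (intro Bochner_Integration.integral_nonneg mult_nonneg_nonneg ball_density_nonneg) auto
  also have "(\<lambda>z. ball_density x r z * (g z - a)\<^sup>2) =
      (\<lambda>z. ball_density x r z * (g z)\<^sup>2 - 2 * a * (ball_density x r z * g z) + a\<^sup>2 * ball_density x r z)"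
    by (auto simp: power2_eq_square algebra_simps)
  also have "(\<integral>z. ball_density x r z * (g z)\<^sup>2 - 2 * a * (ball_density x r z * g z) + a\<^sup>2 * ball_density x r z \<partial>\<mu>)
      = (\<integral>z. ball_density x r z * (g z)\<^sup>2 \<partial>\<mu>) - 2 * a * a + a\<^sup>2"
    using int ball_density_integral[OF pos] by (simp add: a_def)
  finally show ?thesis by (simp add: a_def power2_eq_square)
qed

text \<open>These are the points of the topological support of \<mu>.\<close>

definition charged :: "'a \<Rightarrow> bool" where
  "charged x \<longleftrightarrow> (\<forall>r>0. measure \<mu> (ball x r) > 0)"

lemma ball_average_tendsto:
  assumes x: "charged x" and cont: "isCont \<phi> x"
    and int: "\<And>r. integrable \<mu> (\<lambda>z. ball_density x r z * \<phi> z)"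
  shows "((\<lambda>r. \<integral>z. ball_density x r z * \<phi> z \<partial>\<mu>) \<longlongrightarrow> \<phi> x) (at_right 0)"
proof (rule tendstoI)
  fix e :: real assume "e > 0"
  then obtain d where d: "d > 0" "\<And>z. dist z x < d \<Longrightarrow> dist (\<phi> z) (\<phi> x) < e / 2"
    using cont by (auto simp: continuous_at_eps_delta dest: spec[of _ "e / 2"])
  have "\<forall>\<^sub>F r in at_right (0::real). r < d" "\<forall>\<^sub>F r in at_right (0::real). r > 0"
    using d by (auto simp: eventually_at_right_less eventually_at_right_field)
  then show "\<forall>\<^sub>F r in at_right 0. dist (\<integral>z. ball_density x r z * \<phi> z \<partial>\<mu>) (\<phi> x) < e"
  proof eventually_elim
    case (elim r)
    have "\<bar>(\<integral>z. ball_density x r z * \<phi> z \<partial>\<mu>) - \<phi> x\<bar> \<le> e / 2"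
    proof (rule ball_average_near[OF _ int])
      show "0 < measure \<mu> (ball x r)" using x elim by (auto simp: charged_def)
      show "\<bar>\<phi> z - \<phi> x\<bar> \<le> e / 2" if "dist x z < r" for z
        using d(2)[of z] that elim by (auto simp: dist_commute dist_real_def abs_minus_commute)
    qed
    then show ?case using \<open>e > 0\<close> by (simp add: dist_real_def)
  qed
qed

text \<open>The kernel is within \<open>e / 2\<close> of its value at \<open>(x, y)\<close> on the
  product of the two balls. Averaging first over the ball around \<open>y\<close>, uniformly in
  \<open>z\<close>, and then over the ball around \<open>x\<close> preserves this bound;
  \<open>x = y\<close> is allowed.\<close>

lemma kernel_average_tendsto:
  assumes x: "charged x" and y: "charged y"
  shows "((\<lambda>r. \<integral>z. ball_density x r z * Op (mds_kernel_T \<mu>) (ball_density y r) z \<partial>\<mu>)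
    \<longlongrightarrow> mds_kernel_T \<mu> x y) (at_right 0)"
proof (rule tendstoI)
  fix e :: real assume "e > 0"
  then obtain d where d: "d > 0"
    "\<And>z w. dist x z < d \<Longrightarrow> dist y w < d \<Longrightarrow> \<bar>mds_kernel_T \<mu> z w - mds_kernel_T \<mu> x y\<bar> < e / 2"
    using mds_kernel_T_near[of "e / 2" x y] by auto
  have "\<forall>\<^sub>F r in at_right (0::real). r < d" "\<forall>\<^sub>F r in at_right (0::real). r > 0"
    using d by (auto simp: eventually_at_right_less eventually_at_right_field)
  then show "\<forall>\<^sub>F r in at_right 0. dist (\<integral>z. ball_density x r z * Op (mds_kernel_T \<mu>) (ball_density y r) z \<partial>\<mu>)
      (mds_kernel_T \<mu> x y) < e"
  proof eventually_elim
    case (elim r)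
    have pos: "0 < measure \<mu> (ball x r)" "0 < measure \<mu> (ball y r)"
      using x y elim by (auto simp: charged_def)
    have "\<bar>(\<integral>z. ball_density x r z * Op (mds_kernel_T \<mu>) (ball_density y r) z \<partial>\<mu>) - mds_kernel_T \<mu> x y\<bar> \<le> e / 2"
    proof (rule ball_average_near[OF pos(1)])
      show "integrable \<mu> (\<lambda>z. ball_density x r z * Op (mds_kernel_T \<mu>) (ball_density y r) z)"
        by (intro L2_mult_integrable ball_density_L2 Op_L2 mds_kernel_T_growth)
      fix z assume z: "dist x z < r"
      have "\<bar>(\<integral>w. ball_density y r w * mds_kernel_T \<mu> z w \<partial>\<mu>) - mds_kernel_T \<mu> x y\<bar> \<le> e / 2"
      proof (rule ball_average_near[OF pos(2)])
        show "integrable \<mu> (\<lambda>w. ball_density y r w * mds_kernel_T \<mu> z w)"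
          by (intro L2_mult_integrable ball_density_L2 growth_kernel_section_L2 mds_kernel_T_growth)
        show "\<bar>mds_kernel_T \<mu> z w - mds_kernel_T \<mu> x y\<bar> \<le> e / 2" if "dist y w < r" for w
          using d(2)[of z w] z that elim by auto
      qed
      then show "\<bar>Op (mds_kernel_T \<mu>) (ball_density y r) z - mds_kernel_T \<mu> x y\<bar> \<le> e / 2"
        by (simp add: Op_def mult.commute)
    qed
    then show ?case using \<open>e > 0\<close> by (simp add: dist_real_def)
  qed
qed

lemma lebesgue_point_charged:
  assumes "lebesgue_point \<mu> f x"
  shows "charged x"
  using assms by (auto simp: lebesgue_point_def charged_def emeasure_eq_measure)

text \<open>Integrability over small balls comes from the Lebesgue condition itself: the mean
  deviation \<open>D r\<close> tends to 0 and so is eventually finite. It also bounds the difference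
  between the average and the value at \<open>x\<close>.\<close>

lemma lebesgue_point_average:
  assumes x: "lebesgue_point \<mu> f x" and f [measurable]: "f \<in> borel_measurable \<mu>"
    and fin: "AE y in \<mu>. f y < \<infinity>"
  shows "\<forall>\<^sub>F r in at_right 0. integrable \<mu> (\<lambda>z. ball_density x r z * enn2real (f z))"
    and "((\<lambda>r. \<integral>z. ball_density x r z * enn2real (f z) \<partial>\<mu>) \<longlongrightarrow> enn2real (f x)) (at_right 0)"
proof -
  define F where "F z = enn2real (f z)" for z
  have [measurable]: "F \<in> borel_measurable \<mu>" unfolding F_def by measurable
  have cx: "charged x" by (rule lebesgue_point_charged[OF x])
  define D where "D r = (\<integral>\<^sup>+y\<in>ball x r. e2ennreal \<bar>enn2ereal (f y) - enn2ereal (f x)\<bar> \<partial>\<mu>) / emeasure \<mu> (ball x r)" for r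
  have D0: "(D \<longlongrightarrow> 0) (at_right 0)" using x unfolding D_def by (simp add: lebesgue_point_def)
  \<comment> \<open>At finite values the extended difference is an ordinary one; as \<open>f\<close>
    is finite almost everywhere, the mean deviation becomes one of real functions.\<close>
  have abs_eq: "e2ennreal \<bar>enn2ereal a - enn2ereal b\<bar> = ennreal \<bar>enn2real a - enn2real b\<bar>"
    if "a < \<infinity>" "b < \<infinity>" for a b
  proof (cases a; cases b)
    fix s t :: real assume *: "a = ennreal s" "0 \<le> s" "b = ennreal t" "0 \<le> t"
    then have "e2ennreal \<bar>enn2ereal a - enn2ereal b\<bar> = e2ennreal (ereal \<bar>s - t\<bar>)"
      by (simp add: enn2ereal_ennreal)
    also have "\<dots> = ennreal \<bar>s - t\<bar>" by simp
    finally show ?thesis using * by simp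
  qed (use that in auto)
  have D_eq: "D r = (\<integral>\<^sup>+y. ennreal (ball_density x r y * \<bar>F y - F x\<bar>) \<partial>\<mu>)" if "r > 0" for r
  proof -
    have m: "measure \<mu> (ball x r) > 0" using cx that by (simp add: charged_def)
    have [measurable]: "ball x r \<in> sets \<mu>" by (simp add: sets_eq)
    have "(\<integral>\<^sup>+y\<in>ball x r. e2ennreal \<bar>enn2ereal (f y) - enn2ereal (f x)\<bar> \<partial>\<mu>) =
        (\<integral>\<^sup>+y. ennreal \<bar>F y - F x\<bar> * indicator (ball x r) y \<partial>\<mu>)"
      using fin x by (intro nn_integral_cong_AE) (auto simp: abs_eq F_def lebesgue_point_def)
    then have "D r = (\<integral>\<^sup>+y. ennreal \<bar>F y - F x\<bar> * indicator (ball x r) y / emeasure \<mu> (ball x r) \<partial>\<mu>)"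
      by (simp add: D_def nn_integral_divide)
    also have "\<dots> = (\<integral>\<^sup>+y. ennreal (ball_density x r y * \<bar>F y - F x\<bar>) \<partial>\<mu>)"
      using m by (intro nn_integral_cong)
        (auto simp: ball_density_def emeasure_eq_measure divide_ennreal indicator_def)
    finally show ?thesis .
  qed
  have ev: "\<forall>\<^sub>F r in at_right 0. integrable \<mu> (\<lambda>z. ball_density x r z * F z) \<and>
      \<bar>(\<integral>z. ball_density x r z * F z \<partial>\<mu>) - F x\<bar> < e" if e: "e > 0" for e :: real
  proof -
    have "\<forall>\<^sub>F r in at_right 0. D r < ennreal e" "\<forall>\<^sub>F r in at_right (0::real). r > 0"
      using e by (auto intro!: order_tendstoD(2)[OF D0] simp: eventually_at_right_less)
    then show ?thesis
    proof eventually_elim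
      case (elim r)
      have m: "measure \<mu> (ball x r) > 0" using cx elim by (simp add: charged_def)
      have abs_G: "\<bar>ball_density x r z * (F z - F x)\<bar> = ball_density x r z * \<bar>F z - F x\<bar>" for z
        by (simp add: abs_mult ball_density_nonneg)
      have lt: "(\<integral>\<^sup>+z. ennreal \<bar>ball_density x r z * (F z - F x)\<bar> \<partial>\<mu>) < ennreal e"
        using elim by (simp add: D_eq abs_G)
      have G: "integrable \<mu> (\<lambda>z. ball_density x r z * (F z - F x))"
        using lt by (intro integrableI_bounded) (auto intro: less_trans)
      have dx: "integrable \<mu> (\<lambda>z. ball_density x r z * F x)"
        using L2_integrable[OF ball_density_L2] by auto
      have int: "integrable \<mu> (\<lambda>z. ball_density x r z * F z)"
        using Bochner_Integration.integrable_add[OF G dx] by (simp add: algebra_simps)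
      have "ennreal \<bar>\<integral>z. ball_density x r z * (F z - F x) \<partial>\<mu>\<bar> < ennreal e"
        using integral_norm_bound_ennreal[OF G] lt by simp
      then have "\<bar>\<integral>z. ball_density x r z * (F z - F x) \<partial>\<mu>\<bar> < e"
        by (simp add: ennreal_less_iff)
      then show ?case
        using int dx ball_density_integral[OF m] L2_integrable[OF ball_density_L2, of x r] by (simp add: right_diff_distrib)
    qed
  qed
  from ev[of 1] show "\<forall>\<^sub>F r in at_right 0. integrable \<mu> (\<lambda>z. ball_density x r z * enn2real (f z))"
    by (simp add: F_def eventually_conj_iff)
  show "((\<lambda>r. \<integral>z. ball_density x r z * enn2real (f z) \<partial>\<mu>) \<longlongrightarrow> enn2real (f x)) (at_right 0)"
    using ev by (intro tendstoI) (simp add: F_def eventually_conj_iff dist_real_def)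
qed

section \<open>Pointwise expansion of the kernel at Lebesgue points\<close>

context
  fixes I :: "nat set" and lam :: "nat \<Rightarrow> real" and u :: "nat \<Rightarrow> 'a \<Rightarrow> real"
  assumes basis: "L2_orthonormal_basis \<mu> I u"
    and eigen: "\<And>i. i \<in> I \<Longrightarrow> u i \<in> eigenspace \<mu> (mds_T \<mu>) (lam i)"
begin

text \<open>For \<open>lam i = 0\<close> division by zero makes this the zero function, which need
  not agree with \<open>u i\<close>; hence the condition \<open>lam i \<noteq> 0\<close> in the
  comparisons below.\<close>

abbreviation "rep i \<equiv> continuous_rep \<mu> (lam i) (u i)"

lemma u_L2: "i \<in> I \<Longrightarrow> u i \<in> L2 \<mu>"
  using eigen by (simp add: eigenspace_mds_T)

lemma rep_continuous: "i \<in> I \<Longrightarrow> continuous_on UNIV (rep i)"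
  unfolding continuous_rep_eq_Op by (intro continuous_intros Op_T_continuous u_L2)

lemma rep_AE_eq: "i \<in> I \<Longrightarrow> lam i \<noteq> 0 \<Longrightarrow> AE z in \<mu>. rep i z = u i z"
  using eigen[of i] by (auto simp: eigenspace_mds_T continuous_rep_eq_Op)

lemma weighted_square_sum_measurable [measurable]:
  "weighted_square_sum \<mu> I lam u \<in> borel_measurable \<mu>"
proof -
  have "rep i \<in> borel_measurable \<mu>" if "i \<in> I" for i
    using borel_measurable_continuous_onI[OF rep_continuous[OF that]]
    by (simp cong: measurable_cong_sets[OF sets_eq])
  then have "(\<lambda>x. if i \<in> I then ennreal (\<bar>lam i\<bar> * (rep i x)\<^sup>2) else 0) \<in> borel_measurable \<mu>" for i
    by (cases "i \<in> I") auto
  then show ?thesis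
    unfolding weighted_square_sum_def by (intro borel_measurable_suminf_order)
qed

text \<open>Passage from the series of extended nonnegative reals over all naturals to a real
  unordered sum over \<open>I\<close>: finiteness gives convergence, and nonnegativity makes the
  order irrelevant.\<close>

lemma weighted_square_sum_has_sum:
  assumes "weighted_square_sum \<mu> I lam u x < \<infinity>"
  shows "((\<lambda>i. \<bar>lam i\<bar> * (rep i x)\<^sup>2) has_sum enn2real (weighted_square_sum \<mu> I lam u x)) I"
proof -
  define g where "g i = (if i \<in> I then \<bar>lam i\<bar> * (rep i x)\<^sup>2 else 0)" for i
  have g0: "g i \<ge> 0" for i by (simp add: g_def)
  have eq: "weighted_square_sum \<mu> I lam u x = (\<Sum>i. ennreal (g i))"
    unfolding weighted_square_sum_def by (intro suminf_cong) (simp add: g_def)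
  have sm: "summable g"
    using assms g0 by (intro summable_suminf_not_top) (auto simp: eq)
  have "weighted_square_sum \<mu> I lam u x = ennreal (suminf g)"
    unfolding eq by (intro suminf_ennreal2 g0 sm)
  then have "enn2real (weighted_square_sum \<mu> I lam u x) = suminf g"
    using suminf_nonneg[OF sm g0] by simp
  moreover have "(g has_sum suminf g) UNIV"
    using sums_nonneg_imp_has_sum[OF summable_sums[OF sm]] g0 by simp
  ultimately show ?thesis
    by (subst has_sum_cong_neutral[where T = UNIV and g = g]) (auto simp: g_def)
qed

text \<open>Averages see only the almost-everywhere class of \<open>u i\<close>, so it may be
  replaced by its continuous representative, whose averages converge at every point of the
  support.\<close>

lemma rep_average_tendsto:
  assumes "charged x" and i: "i \<in> I" "lam i \<noteq> 0"
  shows "((\<lambda>r. \<integral>z. ball_density x r z * u i z \<partial>\<mu>) \<longlongrightarrow> rep i x) (at_right 0)"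
    and "((\<lambda>r. \<integral>z. ball_density x r z * (u i z)\<^sup>2 \<partial>\<mu>) \<longlongrightarrow> (rep i x)\<^sup>2) (at_right 0)"
proof -
  have um: "u i \<in> borel_measurable \<mu>" and ui: "integrable \<mu> (u i)" "integrable \<mu> (\<lambda>z. (u i z)\<^sup>2)"
    using u_L2[OF i(1)] L2_integrable[OF u_L2[OF i(1)]] by (auto simp: L2_def[of \<mu>])
  have cont: "isCont (rep i) x"
    using rep_continuous[OF i(1)] by (simp add: continuous_on_eq_continuous_at)
  have rm: "rep i \<in> borel_measurable \<mu>"
    using borel_measurable_continuous_onI[OF rep_continuous[OF i(1)]]
    by (simp cong: measurable_cong_sets[OF sets_eq])
  have bm: "ball_density x r \<in> borel_measurable \<mu>" for r
    using ball_density_L2 by (simp add: L2_def)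
  have eq: "(\<integral>z. ball_density x r z * rep i z \<partial>\<mu>) = (\<integral>z. ball_density x r z * u i z \<partial>\<mu>)"
      "(\<integral>z. ball_density x r z * (rep i z)\<^sup>2 \<partial>\<mu>) = (\<integral>z. ball_density x r z * (u i z)\<^sup>2 \<partial>\<mu>)" for r
    using rep_AE_eq[OF i] um rm bm by (auto intro!: integral_cong_AE)
  have "integrable \<mu> (rep i)" "integrable \<mu> (\<lambda>z. (rep i z)\<^sup>2)"
    using rep_AE_eq[OF i] um rm ui
    by (auto intro: integrable_cong_AE_imp)
  then show "((\<lambda>r. \<integral>z. ball_density x r z * u i z \<partial>\<mu>) \<longlongrightarrow> rep i x) (at_right 0)"
      "((\<lambda>r. \<integral>z. ball_density x r z * (u i z)\<^sup>2 \<partial>\<mu>) \<longlongrightarrow> (rep i x)\<^sup>2) (at_right 0)"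
    using ball_average_tendsto[OF assms(1) cont] ball_average_tendsto[of x "\<lambda>z. (rep i z)\<^sup>2", OF assms(1)] cont
    by (auto simp: eq ball_density_mult_integrable intro!: continuous_intros)
qed

text \<open>Almost everywhere a partial sum of the nonnegative series lies below its total. Keeping
  \<open>G\<close> finite avoids exchanging an infinite sum with the integral, and yields the mass
  bound of the dominated limit.\<close>

lemma partial_sum_average_le:
  assumes G: "finite G" "G \<subseteq> I"
    and fin: "AE z in \<mu>. weighted_square_sum \<mu> I lam u z < \<infinity>"
    and int: "integrable \<mu> (\<lambda>z. ball_density x r z * enn2real (weighted_square_sum \<mu> I lam u z))"
  shows "(\<Sum>i\<in>G. \<bar>lam i\<bar> * (\<integral>z. ball_density x r z * (u i z)\<^sup>2 \<partial>\<mu>))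
    \<le> (\<integral>z. ball_density x r z * enn2real (weighted_square_sum \<mu> I lam u z) \<partial>\<mu>)"
proof -
  have int_i: "integrable \<mu> (\<lambda>z. \<bar>lam i\<bar> * (ball_density x r z * (u i z)\<^sup>2))" if "i \<in> G" for i
    using that G u_L2[of i] by (intro integrable_mult_right ball_density_mult_integrable) (auto simp: L2_def[of \<mu>])
  have eqs: "AE z in \<mu>. \<forall>i\<in>G. lam i \<noteq> 0 \<longrightarrow> rep i z = u i z"
    using G rep_AE_eq by (intro AE_finite_allI AE_impI) auto
  have "(\<Sum>i\<in>G. \<bar>lam i\<bar> * (\<integral>z. ball_density x r z * (u i z)\<^sup>2 \<partial>\<mu>)) =
      (\<integral>z. (\<Sum>i\<in>G. \<bar>lam i\<bar> * (ball_density x r z * (u i z)\<^sup>2)) \<partial>\<mu>)"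
    using int_i by (subst Bochner_Integration.integral_sum) auto
  also have "\<dots> \<le> (\<integral>z. ball_density x r z * enn2real (weighted_square_sum \<mu> I lam u z) \<partial>\<mu>)"
  proof (rule integral_mono_AE[OF _ int])
    show "integrable \<mu> (\<lambda>z. \<Sum>i\<in>G. \<bar>lam i\<bar> * (ball_density x r z * (u i z)\<^sup>2))"
      using int_i by (rule Bochner_Integration.integrable_sum)
    show "AE z in \<mu>. (\<Sum>i\<in>G. \<bar>lam i\<bar> * (ball_density x r z * (u i z)\<^sup>2))
        \<le> ball_density x r z * enn2real (weighted_square_sum \<mu> I lam u z)"
      using fin eqs
    proof eventually_elim
      case (elim z)
      have "(\<Sum>i\<in>G. \<bar>lam i\<bar> * (u i z)\<^sup>2) = (\<Sum>i\<in>G. \<bar>lam i\<bar> * (rep i z)\<^sup>2)"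
        using elim by (intro sum.cong) auto
      also have "\<dots> \<le> enn2real (weighted_square_sum \<mu> I lam u z)"
        by (rule finite_sum_le_has_sum[OF weighted_square_sum_has_sum[OF elim(1)]]) (use G in auto)
      finally show ?case
        using mult_left_mono[OF _ ball_density_nonneg[of x r z]]
        by (fastforce simp: sum_distrib_left mult_ac)
    qed
  qed
  finally show ?thesis .
qed

text \<open>
  The expansion of the kernel in \<open>L2 (\<mu> \<Otimes>\<^sub>M \<mu>)\<close> would not suffice: the diagonal \<open>x = y\<close> is needed
  below and may be a null set.
\<close>

lemma kernel_expansion:
  assumes fin: "AE z in \<mu>. weighted_square_sum \<mu> I lam u z < \<infinity>"
    and x: "lebesgue_point \<mu> (weighted_square_sum \<mu> I lam u) x"
    and y: "lebesgue_point \<mu> (weighted_square_sum \<mu> I lam u) y"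
  shows "((\<lambda>i. lam i * rep i x * rep i y) has_sum mds_kernel_T \<mu> x y) I"
proof -
  define F where "F z = enn2real (weighted_square_sum \<mu> I lam u z)" for z
  define a where "a x r i = (\<integral>z. ball_density x r z * u i z \<partial>\<mu>)" for x r i
  define b where "b x r i = (\<integral>z. ball_density x r z * (u i z)\<^sup>2 \<partial>\<mu>)" for x r i
  define c where "c r i = lam i * a x r i * a y r i" for r i
  define c0 where "c0 i = lam i * rep i x * rep i y" for i
  define p where "p r i = \<bar>lam i\<bar> * b x r i / 2 + \<bar>lam i\<bar> * b y r i / 2" for r i
  define p0 where "p0 i = \<bar>lam i\<bar> * (rep i x)\<^sup>2 / 2 + \<bar>lam i\<bar> * (rep i y)\<^sup>2 / 2" for i
  define A where "A x r = (\<integral>z. ball_density x r z * F z \<partial>\<mu>)" for x r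
  define S where "S r = (\<integral>z. ball_density x r z * Op (mds_kernel_T \<mu>) (ball_density y r) z \<partial>\<mu>)" for r
  have ch: "charged x" "charged y" using x y by (auto intro: lebesgue_point_charged)
  \<comment> \<open>The arithmetic-geometric mean inequality, used for \<open>c0\<close> with exact
    squares and for \<open>c r\<close> with the averages of squares that Jensen's inequality
    provides.\<close>
  have abs_prod: "\<bar>l * s * t\<bar> \<le> \<bar>l\<bar> * s' / 2 + \<bar>l\<bar> * t' / 2" if "s\<^sup>2 \<le> s'" "t\<^sup>2 \<le> t'" for l s t s' t' :: real
  proof -
    have "\<bar>s * t\<bar> \<le> (s' + t') / 2"
      using sum_squares_bound[of s t] sum_squares_bound[of s "-t"] that by (simp add: abs_le_iff)
    from mult_left_mono[OF this, of "\<bar>l\<bar>"] show ?thesis by (simp add: abs_mult field_simps)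
  qed
  have p0: "(p0 has_sum (F x / 2 + F y / 2)) I"
    using has_sum_add[OF has_sum_cmult_right[OF weighted_square_sum_has_sum, of x "1/2"]
        has_sum_cmult_right[OF weighted_square_sum_has_sum, of y "1/2"]] x y
    unfolding p0_def F_def by (simp add: lebesgue_point_def)
  have dom0: "\<bar>c0 i\<bar> \<le> p0 i" for i
    unfolding c0_def p0_def by (rule abs_prod) auto
  \<comment> \<open>Convergence of the expansion is secured first, from finiteness of the weighted
    sum at \<open>x\<close> and \<open>y\<close>; its value is identified at the end by uniqueness
    of limits.\<close>
  have "(\<lambda>i. norm (c0 i)) summable_on I"
    by (rule summable_on_comparison_test[OF has_sum_imp_summable[OF p0]]) (use dom0 in auto)
  then have "c0 summable_on I" by (rule abs_summable_summable)
  then have S0: "(c0 has_sum infsum c0 I) I" by simp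
  have "(S \<longlongrightarrow> infsum c0 I) (at_right 0)"
  proof (rule infsum_tendsto_dominated[where c = c and p = p and ?p0.0 = p0 and ?c0.0 = c0
        and P = "\<lambda>r. A x r / 2 + A y r / 2" and ?P0.0 = "F x / 2 + F y / 2"])
    show "((\<lambda>r. c r i) \<longlongrightarrow> c0 i) (at_right 0)" if "i \<in> I" for i
      unfolding c_def c0_def a_def
      \<comment> \<open>For \<open>lam i = 0\<close> both sides vanish identically, although the
        averages of \<open>u i\<close> need not tend to \<open>rep i x\<close>.\<close>
      by (cases "lam i = 0") (auto intro!: tendsto_intros rep_average_tendsto ch that)
    show "((\<lambda>r. p r i) \<longlongrightarrow> p0 i) (at_right 0)" if "i \<in> I" for i
      unfolding p_def p0_def b_def
      by (cases "lam i = 0") (auto intro!: tendsto_intros rep_average_tendsto ch that)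
    have pos: "\<forall>\<^sub>F r in at_right (0::real). r > 0"
      by (simp add: eventually_at_right_less)
    then show "\<forall>\<^sub>F r in at_right 0. \<forall>i\<in>I. \<bar>c r i\<bar> \<le> p r i"
    proof eventually_elim
      case (elim r)
      then show ?case
        using ch unfolding c_def p_def a_def b_def charged_def
        by (intro ballI abs_prod ball_average_square_le u_L2) auto
    qed
    have "\<forall>\<^sub>F r in at_right 0. integrable \<mu> (\<lambda>z. ball_density x r z * F z)"
        "\<forall>\<^sub>F r in at_right 0. integrable \<mu> (\<lambda>z. ball_density y r z * F z)"
      unfolding F_def by (intro lebesgue_point_average(1) x y fin weighted_square_sum_measurable)+
    then show "\<forall>\<^sub>F r in at_right 0. \<forall>G. finite G \<longrightarrow> G \<subseteq> I \<longrightarrow> sum (p r) G \<le> A x r / 2 + A y r / 2"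
    proof eventually_elim
      case (elim r)
      show ?case
      proof (intro allI impI)
        fix G assume G: "finite G" "G \<subseteq> I"
        have "sum (p r) G = (\<Sum>i\<in>G. \<bar>lam i\<bar> * b x r i) / 2 + (\<Sum>i\<in>G. \<bar>lam i\<bar> * b y r i) / 2"
          by (simp add: p_def sum.distrib sum_divide_distrib)
        also have "\<dots> \<le> A x r / 2 + A y r / 2"
          using elim unfolding A_def b_def F_def
          by (intro add_mono divide_right_mono partial_sum_average_le[OF G fin]) auto
        finally show "sum (p r) G \<le> A x r / 2 + A y r / 2" .
      qed
    qed
    show "((\<lambda>r. A x r / 2 + A y r / 2) \<longlongrightarrow> F x / 2 + F y / 2) (at_right 0)"
      unfolding A_def F_def
      by (intro tendsto_intros lebesgue_point_average(2) x y fin weighted_square_sum_measurable) auto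
    show "\<forall>\<^sub>F r in at_right 0. (c r has_sum S r) I"
    proof (rule always_eventually, rule allI)
      fix r
      have "((\<lambda>i. (\<integral>z. ball_density x r z * u i z \<partial>\<mu>) *
          (\<integral>z. Op (mds_kernel_T \<mu>) (ball_density y r) z * u i z \<partial>\<mu>)) has_sum S r) I"
        unfolding S_def by (intro parseval_inner[OF basis] ball_density_L2 Op_L2 mds_kernel_T_growth)
      then show "(c r has_sum S r) I"
        by (rule has_sum_cong[THEN iffD1, rotated])
          (simp add: eigenspace_inner[OF eigen ball_density_L2] c_def a_def)
    qed
  qed (use dom0 p0 S0 in auto)
  moreover have "(S \<longlongrightarrow> mds_kernel_T \<mu> x y) (at_right 0)"
    unfolding S_def by (rule kernel_average_tendsto[OF ch])
  ultimately have "infsum c0 I = mds_kernel_T \<mu> x y"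
    by (intro tendsto_unique[of "at_right (0::real)"]) auto
  then show ?thesis using S0 unfolding c0_def by simp
qed

lemma dist_sq_has_sum:
  assumes "AE z in \<mu>. weighted_square_sum \<mu> I lam u z < \<infinity>"
    and "lebesgue_point \<mu> (weighted_square_sum \<mu> I lam u) x"
    and "lebesgue_point \<mu> (weighted_square_sum \<mu> I lam u) y"
  shows "((\<lambda>i. lam i * (rep i x - rep i y)\<^sup>2) has_sum (dist x y)\<^sup>2) I"
proof -
  note exp = kernel_expansion[OF assms(1)]
  have "((\<lambda>i. lam i * rep i x * rep i x + lam i * rep i y * rep i y + (- 2) * (lam i * rep i x * rep i y))
      has_sum (mds_kernel_T \<mu> x x + mds_kernel_T \<mu> y y + (- 2) * mds_kernel_T \<mu> x y)) I"
    by (intro has_sum_add has_sum_cmult_right exp assms)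
  then show ?thesis
    unfolding dist_sq_eq by (simp add: power2_eq_square algebra_simps)
qed

end

end

section \<open>Independence of the choice of eigenfunctions\<close>

lemma L2_norm_zero_iff:
  assumes "g \<in> L2 \<mu>"
  shows "(\<integral>x. g x * g x \<partial>\<mu>) = 0 \<longleftrightarrow> (AE x in \<mu>. g x = 0)"
  using assms by (simp add: L2_def integral_nonneg_eq_0_iff_AE flip: power2_eq_square)

text \<open>Pairing a vanishing combination with \<open>h\<close> isolates its coefficient. The
  functions need not be normalised, because the residual added in
  \<open>eigenfunction_expansion\<close> is not.\<close>

lemma orthogonal_imp_independent:
  assumes F: "finite F" and L2: "\<And>g. g \<in> F \<Longrightarrow> g \<in> L2 \<mu>"
    and orth: "\<And>g h. g \<in> F \<Longrightarrow> h \<in> F \<Longrightarrow> g \<noteq> h \<Longrightarrow> (\<integral>x. g x * h x \<partial>\<mu>) = 0"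
    and nz: "\<And>g. g \<in> F \<Longrightarrow> \<not> (AE x in \<mu>. g x = 0)"
  shows "L2_independent \<mu> F"
  unfolding L2_independent_def
proof (intro allI impI ballI)
  fix c h assume ae: "AE x in \<mu>. (\<Sum>g\<in>F. c g * g x) = 0" and h: "h \<in> F"
  have s: "(\<lambda>x. \<Sum>g\<in>F. c g * g x) \<in> L2 \<mu>"
    by (intro L2_sum L2_scale L2)
  have "0 = (\<integral>x. (\<Sum>g\<in>F. c g * g x) * h x \<partial>\<mu>)"
    using ae L2_mult_integrable[OF s L2[OF h]]
    by (subst integral_cong_AE[where g = "\<lambda>_. 0"]) auto
  also have "\<dots> = (\<integral>x. (\<Sum>g\<in>F. c g * (g x * h x)) \<partial>\<mu>)"
    by (simp add: sum_distrib_right mult.assoc)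
  also have "\<dots> = (\<Sum>g\<in>F. c g * (\<integral>x. g x * h x \<partial>\<mu>))"
    using L2 h by (subst Bochner_Integration.integral_sum) (auto intro!: L2_mult_integrable integrable_mult_right)
  also have "\<dots> = (\<Sum>g\<in>F. if g = h then c h * (\<integral>x. h x * h x \<partial>\<mu>) else 0)"
    using orth h by (intro sum.cong) auto
  also have "\<dots> = c h * (\<integral>x. h x * h x \<partial>\<mu>)"
    using F h by simp
  finally show "c h = 0"
    using L2_norm_zero_iff[OF L2[OF h]] nz[OF h] by simp
qed

context mds_space
begin

lemma eigenspace_diff_sum:
  assumes w: "w \<in> eigenspace \<mu> (mds_T \<mu>) l"
    and F: "finite F" "\<And>i. i \<in> F \<Longrightarrow> g i \<in> eigenspace \<mu> (mds_T \<mu>) l"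
  shows "(\<lambda>x. w x - (\<Sum>i\<in>F. c i * g i x)) \<in> eigenspace \<mu> (mds_T \<mu>) l"
proof -
  let ?s = "\<lambda>x. \<Sum>i\<in>F. c i * g i x"
  have g2: "g i \<in> L2 \<mu>" if "i \<in> F" for i using F that by (simp add: eigenspace_mds_T)
  have w2: "w \<in> L2 \<mu>" using w by (simp add: eigenspace_mds_T)
  have s2: "?s \<in> L2 \<mu>" by (intro L2_sum L2_scale g2)
  have "AE x in \<mu>. \<forall>i\<in>F. Op (mds_kernel_T \<mu>) (g i) x = l * g i x"
    using F by (intro AE_finite_allI) (auto simp: eigenspace_mds_T)
  moreover have "AE x in \<mu>. Op (mds_kernel_T \<mu>) w x = l * w x"
    using w by (simp add: eigenspace_mds_T)
  ultimately have "AE x in \<mu>. Op (mds_kernel_T \<mu>) (\<lambda>x. w x - ?s x) x = l * (w x - ?s x)"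
  proof eventually_elim
    case (elim x)
    have "Op (mds_kernel_T \<mu>) (\<lambda>x. w x - ?s x) x = Op (mds_kernel_T \<mu>) w x - Op (mds_kernel_T \<mu>) ?s x"
      using L2_mult_integrable[OF growth_kernel_section_L2[OF mds_kernel_T_growth] w2]
        L2_mult_integrable[OF growth_kernel_section_L2[OF mds_kernel_T_growth] s2]
      by (simp add: Op_def right_diff_distrib)
    then show ?case
      using elim by (simp add: Op_sum[OF mds_kernel_T_growth g2] right_diff_distrib sum_distrib_left mult_ac)
  qed
  then show ?thesis using L2_diff[OF w2 s2] by (simp add: eigenspace_mds_T)
qed

text \<open>Otherwise the residual \<open>r\<close> would be a nonzero eigenfunction orthogonal to
  all \<open>v j\<close>, and adjoining it would give more independent eigenfunctions than the
  multiplicity permits.\<close>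

lemma eigenfunction_expansion:
  assumes J: "finite J" "enat (card J) = multiplicity_of_eigenvalue \<mu> (mds_T \<mu>) l"
    and v: "\<And>j. j \<in> J \<Longrightarrow> v j \<in> eigenspace \<mu> (mds_T \<mu>) l" and on: "L2_orthonormal \<mu> J v"
    and w: "w \<in> eigenspace \<mu> (mds_T \<mu>) l"
  shows "AE x in \<mu>. w x = (\<Sum>j\<in>J. (\<integral>z. w z * v j z \<partial>\<mu>) * v j x)"
proof (rule ccontr)
  assume not_ae: "\<not> ?thesis"
  define r where "r x = w x - (\<Sum>j\<in>J. (\<integral>z. w z * v j z \<partial>\<mu>) * v j x)" for x
  have r: "r \<in> eigenspace \<mu> (mds_T \<mu>) l"
    unfolding r_def[abs_def] by (rule eigenspace_diff_sum[OF w J(1) v])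
  have v2: "v j \<in> L2 \<mu>" if "j \<in> J" for j using v[OF that] by (simp add: eigenspace_mds_T)
  have w2: "w \<in> L2 \<mu>" and r2: "r \<in> L2 \<mu>" using w r by (simp_all add: eigenspace_mds_T)
  have inner: "(\<integral>x. v i x * v j x \<partial>\<mu>) = (if i = j then 1 else 0)" if "i \<in> J" "j \<in> J" for i j
    using on that by (auto simp: L2_orthonormal_def)
  have rv: "(\<integral>x. r x * v k x \<partial>\<mu>) = 0" if k: "k \<in> J" for k
  proof -
    have int: "integrable \<mu> (\<lambda>x. a * (v j x * v k x))" if "j \<in> J" for a j
      using v2 k that by (intro integrable_mult_right L2_mult_integrable)
    have "(\<integral>x. r x * v k x \<partial>\<mu>) =
        (\<integral>x. w x * v k x - (\<Sum>j\<in>J. (\<integral>z. w z * v j z \<partial>\<mu>) * (v j x * v k x)) \<partial>\<mu>)"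
      by (simp add: r_def left_diff_distrib sum_distrib_right mult.assoc)
    also have "\<dots> = (\<integral>x. w x * v k x \<partial>\<mu>) -
        (\<Sum>j\<in>J. (\<integral>z. w z * v j z \<partial>\<mu>) * (\<integral>x. v j x * v k x \<partial>\<mu>))"
      using int L2_mult_integrable[OF w2 v2[OF k]] by (simp add: Bochner_Integration.integral_diff)
    also have "(\<Sum>j\<in>J. (\<integral>z. w z * v j z \<partial>\<mu>) * (\<integral>x. v j x * v k x \<partial>\<mu>)) =
        (\<Sum>j\<in>J. if j = k then (\<integral>z. w z * v k z \<partial>\<mu>) else 0)"
      using inner k by (intro sum.cong) auto
    finally show ?thesis using J(1) k by simp
  qed
  have nz_v: "\<not> (AE x in \<mu>. v j x = 0)" if "j \<in> J" for j
    using L2_norm_zero_iff[OF v2[OF that]] inner[OF that that] by simp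
  have nz_r: "\<not> (AE x in \<mu>. r x = 0)" using not_ae by (simp add: r_def)
  \<comment> \<open>The multiplicity counts functions, not indices, so the \<open>v j\<close> must
    be distinct and \<open>r\<close> must not be among them.\<close>
  have inj: "inj_on v J"
  proof (rule inj_onI)
    fix i j assume ij: "i \<in> J" "j \<in> J" and eq: "v i = v j"
    show "i = j" using inner[OF ij] inner[OF ij(1,1)] by (simp add: eq split: if_splits)
  qed
  have r_notin: "r \<notin> v ` J"
  proof
    assume "r \<in> v ` J"
    then obtain j where j: "j \<in> J" "r = v j" by auto
    show False using rv[OF j(1)] inner[OF j(1) j(1)] by (simp add: j(2))
  qed
  have "L2_independent \<mu> (insert r (v ` J))"
  proof (rule orthogonal_imp_independent)
    fix g h assume "g \<in> insert r (v ` J)" "h \<in> insert r (v ` J)" "g \<noteq> h"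
    then show "(\<integral>x. g x * h x \<partial>\<mu>) = 0"
      using rv inner by (auto simp: mult.commute[of _ "r _"])
  qed (use J r2 v2 nz_v nz_r in auto)
  moreover have "insert r (v ` J) \<subseteq> eigenspace \<mu> (mds_T \<mu>) l" using r v by auto
  ultimately have "enat (card (insert r (v ` J))) \<le> multiplicity_of_eigenvalue \<mu> (mds_T \<mu>) l"
    unfolding multiplicity_of_eigenvalue_def using J(1) by (intro Sup_upper) blast
  moreover have "card (insert r (v ` J)) = Suc (card J)"
    using J(1) r_notin card_image[OF inj] by simp
  ultimately show False unfolding J(2)[symmetric] by simp
qed

text \<open>Both sides are the squared norm of the projection of \<open>h\<close> to the eigenspace.
  The matrix \<open>C\<close> links the two systems: \<open>v j\<close> expands in the
  \<open>u i\<close> by Parseval and orthogonality of distinct eigenspaces, \<open>u i\<close>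
  expands in the \<open>v j\<close> by the multiplicity count, and the double sum is read in both
  orders.\<close>

lemma eigenspace_projection_eq:
  assumes basis: "L2_orthonormal_basis \<mu> I u"
    and eigen: "\<And>i. i \<in> I \<Longrightarrow> u i \<in> eigenspace \<mu> (mds_T \<mu>) (lam i)"
    and finA: "finite {i \<in> I. lam i = l}"
    and J: "finite J" "enat (card J) = multiplicity_of_eigenvalue \<mu> (mds_T \<mu>) l"
    and v: "\<And>j. j \<in> J \<Longrightarrow> v j \<in> eigenspace \<mu> (mds_T \<mu>) l" and on: "L2_orthonormal \<mu> J v"
    and h: "h \<in> L2 \<mu>"
  shows "(\<Sum>i | i \<in> I \<and> lam i = l. (\<integral>z. h z * u i z \<partial>\<mu>)\<^sup>2) = (\<Sum>j\<in>J. (\<integral>z. h z * v j z \<partial>\<mu>)\<^sup>2)"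
proof -
  define A where "A = {i \<in> I. lam i = l}"
  define C where "C i j = (\<integral>z. v j z * u i z \<partial>\<mu>)" for i j
  have v2: "v j \<in> L2 \<mu>" if "j \<in> J" for j using v[OF that] by (simp add: eigenspace_mds_T)
  have hv: "(\<integral>z. h z * v j z \<partial>\<mu>) = (\<Sum>i\<in>A. C i j * (\<integral>z. h z * u i z \<partial>\<mu>))" if j: "j \<in> J" for j
  proof -
    have "((\<lambda>i. C i j * (\<integral>z. h z * u i z \<partial>\<mu>)) has_sum (\<integral>z. v j z * h z \<partial>\<mu>)) I"
      unfolding C_def by (rule parseval_inner[OF basis v2[OF j] h])
    moreover have "C i j = 0" if "i \<in> I - A" for i
      unfolding C_def using that eigen v[OF j] by (intro eigenspace_orthogonal[of _ l _ "lam i"]) (auto simp: A_def)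
    ultimately have "((\<lambda>i. C i j * (\<integral>z. h z * u i z \<partial>\<mu>)) has_sum (\<integral>z. v j z * h z \<partial>\<mu>)) A"
      by (subst has_sum_cong_neutral[where T = I and g = "\<lambda>i. C i j * (\<integral>z. h z * u i z \<partial>\<mu>)"])
        (auto simp: A_def)
    moreover have "finite A" using finA by (simp add: A_def)
    ultimately have "(\<integral>z. v j z * h z \<partial>\<mu>) = (\<Sum>i\<in>A. C i j * (\<integral>z. h z * u i z \<partial>\<mu>))"
      by (intro has_sum_unique[OF _ has_sum_finite])
    then show ?thesis by (simp add: mult.commute)
  qed
  have hu: "(\<integral>z. h z * u i z \<partial>\<mu>) = (\<Sum>j\<in>J. C i j * (\<integral>z. h z * v j z \<partial>\<mu>))" if i: "i \<in> A" for i
  proof -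
    have ui: "u i \<in> eigenspace \<mu> (mds_T \<mu>) l" using eigen i by (auto simp: A_def)
    then have u2: "u i \<in> L2 \<mu>" by (simp add: eigenspace_mds_T)
    have m: "h \<in> borel_measurable \<mu>" "u i \<in> borel_measurable \<mu>" "\<And>j. j \<in> J \<Longrightarrow> v j \<in> borel_measurable \<mu>"
      using h u2 v2 by (auto simp: L2_def)
    have "AE z in \<mu>. u i z = (\<Sum>j\<in>J. C i j * v j z)"
      using eigenfunction_expansion[OF J v on ui] by (simp add: C_def mult.commute)
    then have "(\<integral>z. h z * u i z \<partial>\<mu>) = (\<integral>z. (\<Sum>j\<in>J. C i j * (h z * v j z)) \<partial>\<mu>)"
      using m by (intro integral_cong_AE) (auto simp: sum_distrib_left mult_ac)
    also have "\<dots> = (\<Sum>j\<in>J. C i j * (\<integral>z. h z * v j z \<partial>\<mu>))"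
      using h v2 by (subst Bochner_Integration.integral_sum) (auto intro!: L2_mult_integrable integrable_mult_right)
    finally show ?thesis .
  qed
  have "(\<Sum>j\<in>J. (\<integral>z. h z * v j z \<partial>\<mu>)\<^sup>2) =
      (\<Sum>j\<in>J. \<Sum>i\<in>A. C i j * (\<integral>z. h z * u i z \<partial>\<mu>) * (\<integral>z. h z * v j z \<partial>\<mu>))"
    by (intro sum.cong) (simp_all add: power2_eq_square hv sum_distrib_right)
  also have "\<dots> = (\<Sum>i\<in>A. \<Sum>j\<in>J. C i j * (\<integral>z. h z * u i z \<partial>\<mu>) * (\<integral>z. h z * v j z \<partial>\<mu>))"
    by (rule sum.swap)
  also have "\<dots> = (\<Sum>i\<in>A. (\<integral>z. h z * u i z \<partial>\<mu>) * (\<Sum>j\<in>J. C i j * (\<integral>z. h z * v j z \<partial>\<mu>)))"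
    by (simp add: sum_distrib_left mult_ac)
  also have "\<dots> = (\<Sum>i\<in>A. (\<integral>z. h z * u i z \<partial>\<mu>)\<^sup>2)"
    by (intro sum.cong) (simp_all add: power2_eq_square hu[symmetric])
  finally show ?thesis by (simp add: A_def)
qed

text \<open>For \<open>s * lam i > 0\<close> one has \<open>s * lam i = \<bar>lam i\<bar>\<close>,
  so both families are grouped by a common value \<open>t > 0\<close> and compared on each
  eigenspace. Later \<open>h\<close> is a section of the kernel or a difference of two
  sections.\<close>

lemma signed_enumeration_has_sum:
  assumes basis: "L2_orthonormal_basis \<mu> I u"
    and eigen: "\<And>i. i \<in> I \<Longrightarrow> u i \<in> eigenspace \<mu> (mds_T \<mu>) (lam i)"
    and trace: "(\<lambda>i. \<bar>lam i\<bar>) summable_on I"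
    and s: "s = 1 \<or> s = -1" and enum: "signed_eigen_enumeration \<mu> (mds_T \<mu>) s l v"
    and h: "h \<in> L2 \<mu>"
    and V: "((\<lambda>i. \<bar>lam i\<bar> * (1 / lam i * (\<integral>z. h z * u i z \<partial>\<mu>))\<^sup>2) has_sum V) {i \<in> I. s * lam i > 0}"
  shows "((\<lambda>j. (sqrt (l j) * (1 / (s * l j) * (\<integral>z. h z * v j z \<partial>\<mu>)))\<^sup>2) has_sum V) UNIV"
proof -
  have l0: "l j \<ge> 0" for j using enum by (simp add: signed_eigen_enumeration_def)
  have finB: "finite {j. l j = t}" "enat (card {j. l j = t}) = multiplicity_of_eigenvalue \<mu> (mds_T \<mu>) (s * t)"
    if "t > 0" for t
    using enum that by (auto simp: signed_eigen_enumeration_def)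
  have v: "v j \<in> eigenspace \<mu> (mds_T \<mu>) (s * l j)" if "l j > 0" for j
    using enum that by (auto simp: signed_eigen_enumeration_def)
  have on: "L2_orthonormal \<mu> {j. l j > 0} v"
    using enum by (simp add: signed_eigen_enumeration_def)
  \<comment> \<open>A nonzero eigenvalue repeated infinitely often would contradict the trace
    condition.\<close>
  have finA: "finite {i \<in> I. lam i = t}" if "t \<noteq> 0" for t
  proof (rule ccontr)
    assume inf: "infinite {i \<in> I. lam i = t}"
    have "(\<lambda>i. \<bar>lam i\<bar>) summable_on {i \<in> I. lam i = t}"
      by (rule summable_on_subset[OF trace]) auto
    then have "(\<lambda>_. \<bar>t\<bar>) summable_on {i \<in> I. lam i = t}"
      by (rule summable_on_cong[THEN iffD1, rotated]) auto
    then show False using infsum_diverge_constant[OF inf, of "\<bar>t\<bar>"] that by simp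
  qed
  have sA: "s * x = t \<longleftrightarrow> x = s * t" for x t using s by auto
  have fibre: "(\<Sum>i | i \<in> {i \<in> I. s * lam i > 0} \<and> s * lam i = t. \<bar>lam i\<bar> * (1 / lam i * (\<integral>z. h z * u i z \<partial>\<mu>))\<^sup>2) =
      (\<Sum>j | j \<in> {j. l j > 0} \<and> l j = t. (sqrt (l j) * (1 / (s * l j) * (\<integral>z. h z * v j z \<partial>\<mu>)))\<^sup>2)"
      (is "?L = ?R") if t: "t > 0" for t
  proof -
    \<comment> \<open>On this fibre \<open>\<bar>lam i\<bar> / (lam i)\<^sup>2\<close> equals
      \<open>1 / t\<close> for either sign.\<close>
    have "?L = (\<Sum>i | i \<in> I \<and> lam i = s * t. 1 / t * (\<integral>z. h z * u i z \<partial>\<mu>)\<^sup>2)"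
      using s t by (intro sum.cong) (auto simp: power2_eq_square)
    also have "\<dots> = 1 / t * (\<Sum>i | i \<in> I \<and> lam i = s * t. (\<integral>z. h z * u i z \<partial>\<mu>)\<^sup>2)"
      by (rule sum_distrib_left[symmetric])
    also have "\<dots> = 1 / t * (\<Sum>j | l j = t. (\<integral>z. h z * v j z \<partial>\<mu>)\<^sup>2)"
    proof (subst eigenspace_projection_eq[OF basis eigen _ finB[OF t] _ _ h])
      show "finite {i \<in> I. lam i = s * t}" using finA s t by auto
      show "v j \<in> eigenspace \<mu> (mds_T \<mu>) (s * t)" if "j \<in> {j. l j = t}" for j
        using v[of j] that t by auto
      show "L2_orthonormal \<mu> {j. l j = t} v"
        using on t by (auto simp: L2_orthonormal_def)
    qed auto
    also have "\<dots> = (\<Sum>j | l j = t. 1 / t * (\<integral>z. h z * v j z \<partial>\<mu>)\<^sup>2)"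
      by (rule sum_distrib_left)
    also have "\<dots> = ?R"
      using s t by (intro sum.cong) (auto simp: power_mult_distrib power_divide, auto simp: power2_eq_square)
    finally show ?thesis .
  qed
  have "((\<lambda>j. (sqrt (l j) * (1 / (s * l j) * (\<integral>z. h z * v j z \<partial>\<mu>)))\<^sup>2) has_sum V) {j. l j > 0}"
  proof (rule has_sum_fibres[OF V, where p = "\<lambda>i. s * lam i" and q = l])
    fix t assume "t \<in> (\<lambda>i. s * lam i) ` {i \<in> I. s * lam i > 0} \<union> l ` {j. l j > 0}"
    then have t: "t > 0" by auto
    have "finite {i \<in> I. lam i = s * t}" using finA s t by auto
    then show "finite {i \<in> {i \<in> I. s * lam i > 0}. s * lam i = t}"
      by (rule finite_subset[rotated]) (auto simp: sA)
    show "finite {j \<in> {j. l j > 0}. l j = t}"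
      using finB(1)[OF t] by (rule finite_subset[rotated]) auto
  qed (use fibre in auto)
  \<comment> \<open>Indices with \<open>l j = 0\<close>, the padding of the enumeration, contribute
    0 through \<open>sqrt (l j)\<close>.\<close>
  then show ?thesis
    by (subst has_sum_cong_neutral[where T = "{j. l j > 0}"
        and g = "\<lambda>j. (sqrt (l j) * (1 / (s * l j) * (\<integral>z. h z * v j z \<partial>\<mu>)))\<^sup>2"])
      (use l0 in \<open>auto simp: order_less_le\<close>)
qed

lemma continuous_rep_diff_eq:
  assumes "g \<in> L2 \<mu>"
  shows "continuous_rep \<mu> l g x - continuous_rep \<mu> l g y =
    1 / l * (\<integral>z. (mds_kernel_T \<mu> x z - mds_kernel_T \<mu> y z) * g z \<partial>\<mu>)"
  using L2_mult_integrable[OF growth_kernel_section_L2[OF mds_kernel_T_growth] assms]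
  by (simp add: continuous_rep_def left_diff_distrib right_diff_distrib)

text \<open>The set where \<open>P\<close> holds need not be measurable, so the argument runs
  through a measurable null set \<open>N\<close> containing the exceptions.\<close>

lemma AE_pair_both:
  assumes "AE x in \<mu>. P x"
  shows "AE (x, y) in \<mu> \<Otimes>\<^sub>M \<mu>. P x \<and> P y"
proof -
  obtain N where N: "{x \<in> space \<mu>. \<not> P x} \<subseteq> N" "emeasure \<mu> N = 0" "N \<in> sets \<mu>"
    using AE_E[OF assms] .
  then have ae: "AE x in \<mu>. x \<notin> N" by (intro AE_not_in) auto
  note [measurable] = N(3)
  have "AE z in \<mu> \<Otimes>\<^sub>M \<mu>. fst z \<notin> N \<and> snd z \<notin> N"
  proof (rule pair.AE_pair_measure)
    show "{z \<in> space (\<mu> \<Otimes>\<^sub>M \<mu>). fst z \<notin> N \<and> snd z \<notin> N} \<in> sets (\<mu> \<Otimes>\<^sub>M \<mu>)" by measurable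
    show "AE x in \<mu>. AE y in \<mu>. fst (x, y) \<notin> N \<and> snd (x, y) \<notin> N"
      using ae
    proof eventually_elim
      case (elim x)
      then show ?case using ae by simp
    qed
  qed
  then show ?thesis
    by (rule eventually_mono) (use N(1) in \<open>auto simp: split_beta\<close>)
qed

end

section \<open>From spectral sums to the norms of the maps\<close>

lemma ell2_norm_sq_eq:
  assumes "((\<lambda>j. (a j)\<^sup>2) has_sum V) UNIV"
  shows "(ell2_norm a)\<^sup>2 = V"
proof -
  have "(\<Sum>j. (a j)\<^sup>2) = V" using has_sum_imp_sums[OF assms] by (rule sums_unique[symmetric])
  moreover have "0 \<le> V" by (rule has_sum_nonneg[OF assms]) simp
  ultimately show ?thesis by (simp add: ell2_norm_def)
qed

text \<open>Unordered summability of reals is absolute, so the parts of either sign converge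
  separately, and zero eigenvalues contribute nothing. The factors \<open>1 *\<close> and
  \<open>-1 *\<close> match the sign \<open>s\<close> of
  \<open>signed_enumeration_has_sum\<close>.\<close>

lemma has_sum_split_sign:
  fixes lam d :: "'i \<Rightarrow> real"
  assumes W: "((\<lambda>i. lam i * d i) has_sum W) I" and d: "\<And>i. i \<in> I \<Longrightarrow> 0 \<le> d i"
  obtains Vp Vm where "((\<lambda>i. \<bar>lam i\<bar> * d i) has_sum Vp) {i \<in> I. 1 * lam i > 0}"
    "((\<lambda>i. \<bar>lam i\<bar> * d i) has_sum Vm) {i \<in> I. -1 * lam i > 0}" "W = Vp - Vm"
proof -
  let ?P = "{i \<in> I. 1 * lam i > 0}" and ?M = "{i \<in> I. -1 * lam i > 0}"
  have "(\<lambda>i. norm (lam i * d i)) summable_on I"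
    using has_sum_imp_summable[OF W] by (subst summable_on_iff_abs_summable_on_real[symmetric])
  then have sm: "(\<lambda>i. \<bar>lam i\<bar> * d i) summable_on I"
    by (rule summable_on_cong[THEN iffD1, rotated]) (simp add: abs_mult d)
  have "(\<lambda>i. \<bar>lam i\<bar> * d i) summable_on ?P" "(\<lambda>i. \<bar>lam i\<bar> * d i) summable_on ?M"
    by (rule summable_on_subset[OF sm], auto)+
  then obtain Vp Vm where V: "((\<lambda>i. \<bar>lam i\<bar> * d i) has_sum Vp) ?P" "((\<lambda>i. \<bar>lam i\<bar> * d i) has_sum Vm) ?M"
    unfolding summable_on_def by blast
  have "((\<lambda>i. lam i * d i) has_sum Vp) ?P"
    using V(1) by (rule has_sum_cong[THEN iffD1, rotated]) auto
  moreover have "((\<lambda>i. lam i * d i) has_sum - Vm) ?M"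
    using has_sum_uminusI[OF V(2)] by (rule has_sum_cong[THEN iffD1, rotated]) auto
  ultimately have "((\<lambda>i. lam i * d i) has_sum (Vp + - Vm)) (?P \<union> ?M)"
    by (rule has_sum_Un_disjoint) auto
  moreover have "((\<lambda>i. lam i * d i) has_sum W) (?P \<union> ?M)"
    using W by (subst has_sum_cong_neutral[where T = I and g = "\<lambda>i. lam i * d i"]) auto
  ultimately have "W = Vp + - Vm" by (rule has_sum_unique[rotated])
  then have "W = Vp - Vm" by simp
  with V show thesis by (rule that)
qed

theorem corollary4p6:
  fixes \<mu> :: "'a::polish_space measure"
    and I :: "nat set" and lam :: "nat \<Rightarrow> real" and u :: "nat \<Rightarrow> 'a \<Rightarrow> real"
    and lp lm :: "nat \<Rightarrow> real" and up um :: "nat \<Rightarrow> 'a \<Rightarrow> real"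
  assumes "prob_space \<mu>" and "sets \<mu> = sets borel"
    and fourth_moment: "\<exists>x0. integrable \<mu> (\<lambda>y. dist x0 y ^ 4)"
    and basis: "L2_orthonormal_basis \<mu> I u"
    and eigenfunctions: "\<And>i. i \<in> I \<Longrightarrow> u i \<in> eigenspace \<mu> (mds_T \<mu>) (lam i)"
    and trace_class: "(\<lambda>i. \<bar>lam i\<bar>) summable_on I"
    and lebesgue_points: "AE x in \<mu>. lebesgue_point \<mu> (weighted_square_sum \<mu> I lam u) x"
    and pos: "positive_eigen_enumeration \<mu> (mds_T \<mu>) lp up"
    and neg: "negative_eigen_enumeration \<mu> (mds_T \<mu>) lm um"
  shows "(AE x in \<mu>. (mds_map_pos \<mu> lp up x, mds_map_neg \<mu> lm um x) \<in> krein_space) \<and>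
    (AE (x, y) in \<mu> \<Otimes>\<^sub>M \<mu>.
       (ell2_norm (mds_map_pos \<mu> lp up x - mds_map_pos \<mu> lp up y))\<^sup>2 \<ge> (dist x y)\<^sup>2) \<and>
    (AE (x, y) in \<mu> \<Otimes>\<^sub>M \<mu>.
       krein_norm_sq ((mds_map_pos \<mu> lp up x, mds_map_neg \<mu> lm um x)
                    - (mds_map_pos \<mu> lp up y, mds_map_neg \<mu> lm um y)) = (dist x y)\<^sup>2)"
proof -
  obtain x0 where x0: "integrable \<mu> (\<lambda>y. dist x0 y ^ 4)" using fourth_moment by blast
  interpret prob_space \<mu> by fact
  interpret mds_space \<mu> x0
    by unfold_locales (use assms(2) x0 in auto)
  let ?f = "weighted_square_sum \<mu> I lam u" and ?L = "lebesgue_point \<mu> (weighted_square_sum \<mu> I lam u)"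
  let ?Mp = "mds_map_pos \<mu> lp up" and ?Mm = "mds_map_neg \<mu> lm um"
  let ?k = "mds_kernel_T \<mu>"
  have fin: "AE x in \<mu>. ?f x < \<infinity>"
    using lebesgue_points by eventually_elim (simp add: lebesgue_point_def)
  have enum: "signed_eigen_enumeration \<mu> (mds_T \<mu>) 1 lp up" "signed_eigen_enumeration \<mu> (mds_T \<mu>) (-1) lm um"
    using pos neg by (simp_all add: positive_eigen_enumeration_def negative_eigen_enumeration_def)
  have u2: "u i \<in> L2 \<mu>" if "i \<in> I" for i
    using eigenfunctions[OF that] by (simp add: eigenspace_mds_T)
  have up2: "up j \<in> L2 \<mu>" if "lp j \<noteq> 0" for j
    using enum(1) that by (auto simp: signed_eigen_enumeration_def eigenspace_mds_T order_less_le)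
  have um2: "um j \<in> L2 \<mu>" if "lm j \<noteq> 0" for j
    using enum(2) that by (auto simp: signed_eigen_enumeration_def eigenspace_mds_T order_less_le)
  let ?c = "\<lambda>h i. \<bar>lam i\<bar> * (1 / lam i * (\<integral>z. h z * u i z \<partial>\<mu>))\<^sup>2"
  have has_sum_p: "((\<lambda>j. (sqrt (lp j) * (1 / (1 * lp j) * (\<integral>z. h z * up j z \<partial>\<mu>)))\<^sup>2) has_sum V) UNIV"
    if "h \<in> L2 \<mu>" "(?c h has_sum V) {i \<in> I. 1 * lam i > 0}" for h V
    by (rule signed_enumeration_has_sum[OF basis _ trace_class _ enum(1) that]) (auto intro: eigenfunctions)
  have has_sum_m: "((\<lambda>j. (sqrt (lm j) * (1 / (-1 * lm j) * (\<integral>z. h z * um j z \<partial>\<mu>)))\<^sup>2) has_sum V) UNIV"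
    if "h \<in> L2 \<mu>" "(?c h has_sum V) {i \<in> I. -1 * lam i > 0}" for h V
    by (rule signed_enumeration_has_sum[OF basis _ trace_class _ enum(2) that]) (auto intro: eigenfunctions)
  have "(?Mp x, ?Mm x) \<in> krein_space" if "?L x" for x
  proof -
    have "((\<lambda>i. \<bar>lam i\<bar> * (continuous_rep \<mu> (lam i) (u i) x)\<^sup>2) has_sum enn2real (?f x)) I"
      by (rule weighted_square_sum_has_sum[OF basis])
        (use that in \<open>auto simp: lebesgue_point_def intro: eigenfunctions\<close>)
    \<comment> \<open>A representative at \<open>x\<close> is a Fourier coefficient of the section
      \<open>?k x\<close> divided by its eigenvalue, so finiteness of the weighted sum at
      \<open>x\<close> controls both sign parts.\<close>
    then have "?c (?k x) summable_on I"
      by (simp add: continuous_rep_def has_sum_imp_summable)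
    then have "?c (?k x) summable_on {i \<in> I. s * lam i > 0}" for s
      by (rule summable_on_subset) auto
    from this[of 1] this[of "-1"]
    obtain Vp Vm where V: "(?c (?k x) has_sum Vp) {i \<in> I. 1 * lam i > 0}"
        "(?c (?k x) has_sum Vm) {i \<in> I. -1 * lam i > 0}"
      unfolding summable_on_def by blast
    from has_sum_p[OF growth_kernel_section_L2[OF mds_kernel_T_growth] V(1)]
      has_sum_m[OF growth_kernel_section_L2[OF mds_kernel_T_growth] V(2)]
    have "((\<lambda>j. (?Mp x j)\<^sup>2) has_sum Vp) UNIV" "((\<lambda>j. (?Mm x j)\<^sup>2) has_sum Vm) UNIV"
      using growth_kernel_section_L2[OF mds_kernel_T_growth]
      by (simp_all add: mds_map_pos_def mds_map_neg_def continuous_rep_def)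
    then show ?thesis
      by (auto simp: krein_space_def ell2_def dest!: has_sum_imp_sums sums_summable)
  qed
  then have member: "AE x in \<mu>. (?Mp x, ?Mm x) \<in> krein_space"
    using lebesgue_points by (rule eventually_mono[rotated])
  have main: "(ell2_norm (?Mp x - ?Mp y))\<^sup>2 - (ell2_norm (?Mm x - ?Mm y))\<^sup>2 = (dist x y)\<^sup>2"
    if xy: "?L x" "?L y" for x y
  proof -
    let ?h = "\<lambda>z. ?k x z - ?k y z"
    have h: "?h \<in> L2 \<mu>"
      by (rule L2_diff[OF growth_kernel_section_L2 growth_kernel_section_L2]) (rule mds_kernel_T_growth)+
    have Mp_diff: "(?Mp x - ?Mp y) j = sqrt (lp j) * (1 / (1 * lp j) * (\<integral>z. ?h z * up j z \<partial>\<mu>))" for j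
      using up2[of j] by (cases "lp j = 0")
        (auto simp: mds_map_pos_def continuous_rep_diff_eq simp flip: right_diff_distrib)
    have Mm_diff: "(?Mm x - ?Mm y) j = sqrt (lm j) * (1 / (-1 * lm j) * (\<integral>z. ?h z * um j z \<partial>\<mu>))" for j
      using um2[of j] by (cases "lm j = 0")
        (auto simp: mds_map_neg_def continuous_rep_diff_eq simp flip: right_diff_distrib)
    obtain Vp Vm where V:
      "((\<lambda>i. \<bar>lam i\<bar> * (continuous_rep \<mu> (lam i) (u i) x - continuous_rep \<mu> (lam i) (u i) y)\<^sup>2) has_sum Vp) {i \<in> I. 1 * lam i > 0}"
      "((\<lambda>i. \<bar>lam i\<bar> * (continuous_rep \<mu> (lam i) (u i) x - continuous_rep \<mu> (lam i) (u i) y)\<^sup>2) has_sum Vm) {i \<in> I. -1 * lam i > 0}"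
      "(dist x y)\<^sup>2 = Vp - Vm"
      by (rule has_sum_split_sign[OF dist_sq_has_sum[OF basis _ fin xy] zero_le_power2])
        (rule eigenfunctions)
    have "((\<lambda>i. \<bar>lam i\<bar> * (1 / lam i * (\<integral>z. ?h z * u i z \<partial>\<mu>))\<^sup>2) has_sum Vp) {i \<in> I. 1 * lam i > 0}"
      using V(1) by (rule has_sum_cong[THEN iffD1, rotated]) (simp add: continuous_rep_diff_eq u2)
    from has_sum_p[OF h this] have Vp: "((\<lambda>j. ((?Mp x - ?Mp y) j)\<^sup>2) has_sum Vp) UNIV"
      unfolding Mp_diff .
    have "((\<lambda>i. \<bar>lam i\<bar> * (1 / lam i * (\<integral>z. ?h z * u i z \<partial>\<mu>))\<^sup>2) has_sum Vm) {i \<in> I. -1 * lam i > 0}"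
      using V(2) by (rule has_sum_cong[THEN iffD1, rotated]) (simp add: continuous_rep_diff_eq u2)
    from has_sum_m[OF h this] have Vm: "((\<lambda>j. ((?Mm x - ?Mm y) j)\<^sup>2) has_sum Vm) UNIV"
      unfolding Mm_diff .
    show ?thesis
      using V(3) by (simp only: ell2_norm_sq_eq[OF Vp] ell2_norm_sq_eq[OF Vm])
  qed
  have le: "(dist x y)\<^sup>2 \<le> (ell2_norm (?Mp x - ?Mp y))\<^sup>2" if "?L x" "?L y" for x y
    using main[OF that] zero_le_power2[of "ell2_norm (?Mm x - ?Mm y)"] by linarith
  have ae: "AE (x, y) in \<mu> \<Otimes>\<^sub>M \<mu>. ?L x \<and> ?L y"
    by (rule AE_pair_both[OF lebesgue_points])
  show ?thesis
  proof (intro conjI)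
    show "AE x in \<mu>. (?Mp x, ?Mm x) \<in> krein_space" by (rule member)
    show "AE (x, y) in \<mu> \<Otimes>\<^sub>M \<mu>. (ell2_norm (?Mp x - ?Mp y))\<^sup>2 \<ge> (dist x y)\<^sup>2"
      using ae by (rule eventually_mono) (use le in auto)
    show "AE (x, y) in \<mu> \<Otimes>\<^sub>M \<mu>. krein_norm_sq ((?Mp x, ?Mm x) - (?Mp y, ?Mm y)) = (dist x y)\<^sup>2"
      using ae by (rule eventually_mono) (use main in \<open>auto simp: krein_norm_sq_def\<close>)
  qed
qed

end
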